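(* With the notation of the context, for a subset $S\subset\mathcal{D}$ write $\mathrm{Sol}(S)=\{u\in\mathcal{B}_{X_{\mathbb{R}}} \mid Pu=0 \text{ for all } P\in S\}$. Then the following inclusions of subspaces of $\mathcal{B}_{X_{\mathbb{R}}}$ hold (the direct sums over $l$ being internal direct sums in $\mathcal{B}_{X_{\mathbb{R}}}$): $$\begin{array}{ccc} \mathrm{Sol}\bigl((\rho-\chi)(\mathfrak{h}_3)\bigr) & \supset & \mathrm{Sol}(\mathcal{I}_3)\\ \cup & & \cup\\ \displaystyle\bigoplus_{l\in\mathbb{Z}_{\ge 0}}\mathrm{Sol}\bigl((\rho-\chi_l)(\mathfrak{h}_1)\bigr) & \supset & \displaystyle\bigoplus_{l\in\mathbb{Z}_{\ge 0}}\mathrm{Sol}(\mathcal{I}_{1l}). \end{array}$$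
   Context: Let $X=\mathbb{C}^4$ with coordinates $(z_1,z_2,z_3,z_4)$, and let $\mathcal{D}=\mathbb{C}[z_1,\dots,z_4,\frac{\partial}{\partial z_1},\dots,\frac{\partial}{\partial z_4}]$ be the ring of differential operators with polynomial coefficients. Real form: $X_{\mathbb{R}}=\{(z_1,z_2,\overline{z_1},\overline{z_2}) \mid z_1,z_2\in\mathbb{C}\}\simeq\mathbb{R}^4$, a real form of $X$. $\mathcal{B}_{X_{\mathbb{R}}}$ denotes the space of hyperfunctions on $X_{\mathbb{R}}$. The ring $\mathcal{D}$ acts on it by restricting to $X_{\mathbb{R}}$: $z_3,z_4$ act as multiplication by $\overline{z_1},\overline{z_2}$, and $\frac{\partial}{\partial z_1},\frac{\partial}{\partial z_2},\frac{\partial}{\partial z_3},\frac{\partial}{\partial z_4}$ act as the Wirtinger derivatives $\frac{\partial}{\partial z_1},\frac{\partial}{\partial z_2},\frac{\partial}{\partial \overline{z_1}},\frac{\partial}{\partial \overline{z_2}}$. Lie algebras: let $E_{ij}$ be the matrix units of $\mathfrak{gl}(4,\mathbb{C})$. Put $\mathfrak{h}_1=\mathfrak{a}\oplus\mathfrak{n}$ with $\mathfrak{a}=\mathbb{C}E_{11}\oplus\mathbb{C}E_{22}\oplus\mathbb{C}E_{33}\oplus\mathbb{C}E_{44}$ and $\mathfrak{n}=\mathbb{C}E_{14}\oplus\mathbb{C}E_{24}\oplus\mathbb{C}E_{31}\oplus\mathbb{C}E_{32}\oplus\mathbb{C}E_{34}$, and $$\mathfrak{h}_3=\mathbb{C}(E_{11}+E_{22})\oplus\mathbb{C}(E_{33}+E_{44})\oplus\mathbb{C}E_{14}\oplus\mathbb{C}E_{32}\subset\mathfrak{h}_1.$$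 Let $\rho:\mathfrak{gl}(4,\mathbb{C})\to\mathcal{D}$ be the Lie algebra homomorphism $\rho(E_{ij})=-z_j\frac{\partial}{\partial z_i}$. For $l\in\mathbb{Z}_{\ge 0}$ let $\chi_l:\mathfrak{h}_1\to\mathbb{C}$ be the character with $\chi_l(E_{11})=-l$, $\chi_l(E_{22})=l+1$, $\chi_l(E_{33})=0$, $\chi_l(E_{44})=1$, $\chi_l(\mathfrak{n})=0$. Its restriction to $\mathfrak{h}_3$ does not depend on $l$ and is denoted $\chi$; explicitly $\chi(E_{11}+E_{22})=1$, $\chi(E_{33}+E_{44})=1$, $\chi(E_{14})=\chi(E_{32})=0$. Here $(\rho-\chi_l)(\mathfrak{h}_1)=\{\rho(A)-\chi_l(A)\mid A\in\mathfrak{h}_1\}$ and $(\rho-\chi)(\mathfrak{h}_3)=\{\rho(A)-\chi(A)\mid A\in\mathfrak{h}_3\}$. Ideals: for $l\in\mathbb{Z}_{\ge 0}$, $\mathcal{I}_{1l}$ is the left ideal of $\mathcal{D}$ generated by $$z_1\tfrac{\partial}{\partial z_1}-l,\quad \tfrac{\partial^{l+1}}{\partial z_1^{l+1}},\quad z_2\tfrac{\partial}{\partial z_2}+l+1,\quad z_2^{l+1},\quad \tfrac{\partial}{\partial z_3},\quad z_4,$$ and $\mathcal{I}_3$ is the left ideal of $\mathcal{D}$ generated by $z_1\frac{\partial}{\partial z_1}+z_2\frac{\partial}{\partial z_2}+1$, $\frac{\partial}{\partial z_3}$, $z_4$. *)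

theory Defs
  imports "HOL-Complex_Analysis.Cauchy_Integral_Formula"
begin

subsection \<open>Holomorphic functions of four complex variables\<close>

definition cupd :: "complex^4 \<Rightarrow> 4 \<Rightarrow> complex \<Rightarrow> complex^4" where
  "cupd w j t = (\<chi> i. if i = j then t else w $ i)"

text \<open>Only used for open \<open>S\<close>: a function is holomorphic if it is continuous and holomorphic in each
  variable separately (Osgood; equivalently, complex differentiable).\<close>

definition holo :: "(complex^4) set \<Rightarrow> (complex^4 \<Rightarrow> complex) \<Rightarrow> bool" where
  "holo S f \<longleftrightarrow> continuous_on S f \<and>
     (\<forall>w\<in>S. \<forall>j. (\<lambda>t. f (cupd w j t)) field_differentiable at (w $ j))"

definition pderivative :: "4 \<Rightarrow> (complex^4 \<Rightarrow> complex) \<Rightarrow> complex^4 \<Rightarrow> complex" where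
  "pderivative j f w = deriv (\<lambda>t. f (cupd w j t)) (w $ j)"

lemma cupd_nth [simp]: "cupd w j t $ i = (if i = j then t else w $ i)"
  by (simp add: cupd_def)

lemma cupd_same [simp]: "cupd w j (w $ j) = w"
  by (simp add: vec_eq_iff)

lemma cupd_cupd [simp]: "cupd (cupd w j s) j t = cupd w j t"
  by (simp add: vec_eq_iff)

lemma cupd_commute: "j \<noteq> k \<Longrightarrow> cupd (cupd w j s) k t = cupd (cupd w k t) j s"
  by (simp add: vec_eq_iff)

lemma continuous_on_cupd [continuous_intros]:
  assumes "continuous_on A f" "continuous_on A g"
  shows "continuous_on A (\<lambda>x. cupd (f x) j (g x))"
proof -
  have "continuous_on A (\<lambda>x. if i = j then g x else f x $ i)" for i
    using assms by (cases "i = j") (auto intro: continuous_intros)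
  then show ?thesis unfolding cupd_def by (intro continuous_on_vec_lambda)
qed

lemma dist_cupd_le:
  "dist (cupd w j t) w0 \<le> 2 * dist w w0 + dist t (w0 $ j)"
proof -
  have e: "cupd w j t - w0 = (w - w0) + axis j (t - w $ j)"
    by (simp add: vec_eq_iff axis_def)
  have "norm (axis j (t - w $ j) :: complex^4) \<le> norm (t - w $ j)"
  proof -
    have "norm (axis j (t - w $ j) :: complex^4) \<le> (\<Sum>i\<in>UNIV. norm (axis j (t - w $ j) $ i))"
      unfolding norm_vec_def by (rule L2_set_le_sum) simp
    also have "(\<Sum>i\<in>UNIV. norm (axis j (t - w $ j) $ i)) = (\<Sum>i\<in>UNIV. if i = j then norm (t - w $ j) else 0)"
      by (intro sum.cong) (auto simp: axis_def)
    finally show ?thesis by simp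
  qed
  also have "\<dots> \<le> norm (t - w0 $ j) + norm ((w0 - w) $ j)"
    using norm_triangle_ineq[of "t - w0 $ j" "w0 $ j - w $ j"] by simp
  also have "norm ((w0 - w) $ j) \<le> norm (w0 - w)"
    using dist_vec_nth_le[of w0 j w] by (simp add: dist_norm)
  finally have "norm (axis j (t - w $ j) :: complex^4) \<le> norm (t - w0 $ j) + norm (w - w0)"
    by (simp add: norm_minus_commute)
  with norm_triangle_ineq[of "w - w0" "axis j (t - w $ j)"] show ?thesis
    unfolding dist_norm e by linarith
qed

lemma holo_subset: "holo T f \<Longrightarrow> S \<subseteq> T \<Longrightarrow> holo S f"
  unfolding holo_def by (meson continuous_on_subset subsetD)

lemma holo_slice_open:
  assumes "open S" shows "open {t. cupd w j t \<in> S}"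
proof -
  have "continuous_on UNIV (\<lambda>t. cupd w j t)" by (intro continuous_intros)
  from open_vimage[OF assms this] show ?thesis by (simp add: vimage_def)
qed

lemma holo_slice:
  assumes "holo S f"
  shows "(\<lambda>t. f (cupd w j t)) holomorphic_on {t. cupd w j t \<in> S}"
  unfolding holomorphic_on_def
proof
  fix t assume "t \<in> {t. cupd w j t \<in> S}"
  then have "(\<lambda>s. f (cupd (cupd w j t) j s)) field_differentiable at (cupd w j t $ j)"
    using assms unfolding holo_def by blast
  then show "(\<lambda>t. f (cupd w j t)) field_differentiable at t within {t. cupd w j t \<in> S}"
    by (simp add: field_differentiable_at_within)
qed

lemma pderivative_cupd: "pderivative j f (cupd w j t) = deriv (\<lambda>s. f (cupd w j s)) t"
  by (simp add: pderivative_def)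

lemma pderivative_slice:
  assumes "holo S f" "w \<in> S"
  shows "((\<lambda>t. f (cupd w j t)) has_field_derivative pderivative j f w) (at (w $ j))"
  using assms by (auto simp: holo_def pderivative_def DERIV_deriv_iff_field_differentiable)

lemma pderivative_slice':
  assumes "holo S f" "cupd w j s \<in> S"
  shows "((\<lambda>t. f (cupd w j t)) has_field_derivative pderivative j f (cupd w j s)) (at s)"
  using pderivative_slice[OF assms, of j] by simp

definition ckernel :: "4 \<Rightarrow> complex \<Rightarrow> real \<Rightarrow> (complex^4 \<Rightarrow> complex) \<Rightarrow> complex^4 \<Rightarrow> real \<Rightarrow> complex" where
  "ckernel j z r f w x =
     f (cupd w j (circlepath z r x)) / (circlepath z r x - w $ j)\<^sup>2 *
     (2 * of_real pi * \<i> * r * exp (2 * of_real pi * \<i> * x))"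

definition poly_ball :: "(complex^4) set \<Rightarrow> complex^4 \<Rightarrow> real \<Rightarrow> bool" where
  "poly_ball S w0 r \<longleftrightarrow> r > 0 \<and> (\<forall>w\<in>ball w0 r. \<forall>j. \<forall>t\<in>cball (w0 $ j) r. cupd w j t \<in> S)"

lemma poly_ball_exists:
  assumes "open S" "w0 \<in> S" shows "\<exists>r. poly_ball S w0 r"
proof -
  obtain e where e: "e > 0" "ball w0 e \<subseteq> S"
    using assms by (meson openE)
  have "cupd w j t \<in> S" if "w \<in> ball w0 (e/4)" "t \<in> cball (w0 $ j) (e/4)" for w j t
  proof -
    have "dist (cupd w j t) w0 < e"
      using dist_cupd_le[of w j t w0] that \<open>e > 0\<close> by (simp add: dist_commute)
    then show ?thesis using e by (auto simp: dist_commute)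
  qed
  then show ?thesis using e unfolding poly_ball_def by (intro exI[of _ "e/4"]) auto
qed

lemma circlepath_in: "0 < r \<Longrightarrow> circlepath z r x \<in> cball z r"
  by (simp add: circlepath dist_norm norm_mult)

lemma circlepath_ne:
  assumes "w \<in> ball w0 r" shows "circlepath (w0 $ j) r x \<noteq> w $ j"
proof
  assume "circlepath (w0 $ j) r x = w $ j"
  moreover have "dist (w0 $ j) (circlepath (w0 $ j) r x) = \<bar>r\<bar>"
    by (simp add: circlepath dist_norm norm_mult)
  ultimately have "dist (w0 $ j) (w $ j) = \<bar>r\<bar>" by simp
  with dist_vec_nth_le[of w0 j w] assms show False by simp
qed

lemma continuous_ckernel:
  assumes f: "continuous_on S f" and p: "poly_ball S w0 r"
  shows "continuous_on (ball w0 r \<times> cbox 0 1) (\<lambda>(w, x). ckernel j (w0 $ j) r f w x)"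
proof -
  have r: "r > 0" using p by (simp add: poly_ball_def)
  have c: "continuous_on A (\<lambda>y. circlepath (w0 $ j) r (g y))" if "continuous_on A g" for A and g :: "(complex^4) \<times> real \<Rightarrow> real"
    unfolding circlepath using that by (intro continuous_intros)
  have "continuous_on (ball w0 r \<times> cbox 0 1) (\<lambda>y. f (cupd (fst y) j (circlepath (w0 $ j) r (snd y))))"
    using p circlepath_in[OF r]
    by (intro continuous_on_compose2[OF f] continuous_intros c) (auto simp: poly_ball_def)
  moreover have "continuous_on (ball w0 r \<times> cbox 0 1) (\<lambda>y. (circlepath (w0 $ j) r (snd y) - fst y $ j)\<^sup>2)"
    by (intro continuous_on_power continuous_on_diff c continuous_on_component continuous_on_fst continuous_on_snd continuous_on_id)
  moreover have "continuous_on (ball w0 r \<times> cbox 0 1)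
      (\<lambda>y. 2 * of_real pi * \<i> * of_real r * exp (2 * of_real pi * \<i> * of_real (snd y :: real)) :: complex)"
    by (intro continuous_on_mult continuous_on_const continuous_on_exp continuous_on_of_real continuous_on_snd continuous_on_id)
  moreover have "(circlepath (w0 $ j) r (snd y) - fst y $ j)\<^sup>2 \<noteq> 0" if "y \<in> ball w0 r \<times> cbox 0 1" for y
    using circlepath_ne[of "fst y" w0 r j "snd y"] that by auto
  ultimately show ?thesis
    unfolding ckernel_def split_beta by - (rule continuous_on_mult, rule continuous_on_divide, blast+)
qed

lemma pderivative_integral:
  assumes f: "holo S f" and p: "poly_ball S w0 r" and w: "w \<in> ball w0 r"
  shows "pderivative j f w =
     1 / (2 * of_real pi * \<i>) * integral (cbox 0 1) (ckernel j (w0 $ j) r f w)"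
proof -
  have r: "r > 0" using p by (simp add: poly_ball_def)
  have sub: "cball (w0 $ j) r \<subseteq> {t. cupd w j t \<in> S}"
    using p w by (auto simp: poly_ball_def)
  have hol: "(\<lambda>t. f (cupd w j t)) holomorphic_on cball (w0 $ j) r"
    using holo_slice[OF f] sub by (rule holomorphic_on_subset)
  have wj: "w $ j \<in> ball (w0 $ j) r"
    using dist_vec_nth_le[of w0 j w] w by simp
  have "((\<lambda>t. f (cupd w j t)) has_field_derivative
      1 / (2 * of_real pi * \<i>) * contour_integral (circlepath (w0 $ j) r)
        (\<lambda>u. f (cupd w j u) / (u - w $ j)^2)) (at (w $ j))"
    by (rule Cauchy_derivative_integral_circlepath(2))
       (use hol wj in \<open>auto intro: holomorphic_on_imp_continuous_on holomorphic_on_subset\<close>)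
  then have "pderivative j f w = 1 / (2 * of_real pi * \<i>) * contour_integral (circlepath (w0 $ j) r)
        (\<lambda>u. f (cupd w j u) / (u - w $ j)^2)"
    unfolding pderivative_def by (rule DERIV_imp_deriv)
  also have "contour_integral (circlepath (w0 $ j) r) (\<lambda>u. f (cupd w j u) / (u - w $ j)^2) =
     integral (cbox 0 1) (ckernel j (w0 $ j) r f w)"
    unfolding contour_integral_integral ckernel_def box_real
    by (intro Henstock_Kurzweil_Integration.integral_cong) (simp add: vector_derivative_circlepath)
  finally show ?thesis .
qed

lemma continuous_pderivative:
  assumes S: "open S" and f: "holo S f" shows "continuous_on S (pderivative j f)"
proof -
  have "isCont (pderivative j f) w0" if w0: "w0 \<in> S" for w0
  proof -
    obtain r where p: "poly_ball S w0 r" using poly_ball_exists[OF S w0] by blast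
    then have r: "r > 0" by (simp add: poly_ball_def)
    have "continuous_on (ball w0 r) (\<lambda>w. 1 / (2 * of_real pi * \<i>) * integral (cbox 0 1) (ckernel j (w0 $ j) r f w))"
      using f by (intro continuous_intros integral_continuous_on_param continuous_ckernel[OF _ p])
                 (simp add: holo_def)
    then have "continuous_on (ball w0 r) (pderivative j f)"
      by (rule continuous_on_eq) (simp add: pderivative_integral[OF f p])
    then show ?thesis using r by (simp add: continuous_on_eq_continuous_at)
  qed
  then show ?thesis by (simp add: continuous_at_imp_continuous_on)
qed

lemma pderivative_slice_other:
  assumes S: "open S" and f: "holo S f" and p: "poly_ball S w0 r" and jk: "j \<noteq> k"
  shows "((\<lambda>s. pderivative j f (cupd w0 k s)) has_field_derivative
     1 / (2 * of_real pi * \<i>) * integral (cbox 0 1) (ckernel j (w0 $ j) r (pderivative k f) w0)) (at (w0 $ k))"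
proof -
  let ?U = "ball (w0 $ k) r"
  have r: "r > 0" using p by (simp add: poly_ball_def)
  have U: "cupd w0 k s \<in> ball w0 r" if "s \<in> ?U" for s
    using dist_cupd_le[of w0 k s w0] that by (simp add: dist_commute)
  have in_S: "cupd (cupd w0 k s) j (circlepath (w0 $ j) r x) \<in> S" if "s \<in> ?U" for s x
    using p U[OF that] circlepath_in[OF r] by (auto simp: poly_ball_def)
  have d: "((\<lambda>s. ckernel j (w0 $ j) r f (cupd w0 k s) x) has_field_derivative
      ckernel j (w0 $ j) r (pderivative k f) (cupd w0 k s) x) (at s within ?U)"
    if "s \<in> ?U" for s x
  proof -
    let ?v = "cupd w0 j (circlepath (w0 $ j) r x)"
    have "((\<lambda>t. f (cupd ?v k t)) has_field_derivative pderivative k f (cupd ?v k s)) (at s)"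
      using in_S[OF that, of x] by (intro pderivative_slice'[OF f]) (simp add: cupd_commute[OF jk])
    then have "((\<lambda>t. f (cupd ?v k t)) has_field_derivative pderivative k f (cupd ?v k s)) (at s within ?U)"
      by (rule has_field_derivative_at_within)
    from DERIV_cdivide[OF this, THEN DERIV_cmult_right] show ?thesis
      unfolding ckernel_def using jk by (simp add: cupd_commute[OF jk])
  qed
  have cU: "continuous_on (?U \<times> cbox 0 1) (\<lambda>(s, x). ckernel j (w0 $ j) r h (cupd w0 k s) x)"
    if "continuous_on S h" for h
  proof -
    have c: "continuous_on (?U \<times> cbox 0 1) (\<lambda>y. (cupd w0 k (fst y), snd y :: real))"
      by (intro continuous_on_Pair continuous_on_cupd continuous_on_const continuous_on_fst
                continuous_on_snd continuous_on_id)
    have "(\<lambda>y. (cupd w0 k (fst y), snd y)) ` (?U \<times> cbox 0 1) \<subseteq> ball w0 r \<times> cbox 0 (1 :: real)"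
      using U by force
    note continuous_on_compose2[OF continuous_ckernel[OF that p] c this]
    then show ?thesis by (simp add: split_beta)
  qed
  have "((\<lambda>s. integral (cbox 0 1) (ckernel j (w0 $ j) r f (cupd w0 k s))) has_field_derivative
     integral (cbox 0 1) (ckernel j (w0 $ j) r (pderivative k f) (cupd w0 k (w0 $ k)))) (at (w0 $ k) within ?U)"
  proof (rule leibniz_rule_field_derivative[OF d])
    show "ckernel j (w0 $ j) r f (cupd w0 k s) integrable_on cbox 0 1" if "s \<in> ?U" for s
    proof (rule integrable_continuous)
      have "continuous_on (cbox 0 1) (\<lambda>x. (\<lambda>(s, x). ckernel j (w0 $ j) r f (cupd w0 k s) x) (s, x))"
        by (rule continuous_on_compose2[OF cU[of f]])
           (use f that in \<open>auto simp: holo_def intro!: continuous_on_Pair\<close>)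
      then show "continuous_on (cbox 0 1) (ckernel j (w0 $ j) r f (cupd w0 k s))" by simp
    qed
    show "continuous_on (?U \<times> cbox 0 1) (\<lambda>(s, x). ckernel j (w0 $ j) r (pderivative k f) (cupd w0 k s) x)"
      by (rule cU[OF continuous_pderivative[OF S f]])
  qed (use r in auto)
  from DERIV_cmult[OF this, of "1 / (2 * of_real pi * \<i>)"]
  have "((\<lambda>s. 1 / (2 * of_real pi * \<i>) * integral (cbox 0 1) (ckernel j (w0 $ j) r f (cupd w0 k s)))
     has_field_derivative
     1 / (2 * of_real pi * \<i>) * integral (cbox 0 1) (ckernel j (w0 $ j) r (pderivative k f) w0)) (at (w0 $ k) within ?U)"
    by simp
  from this[unfolded at_within_open[OF centre_in_ball[THEN iffD2, OF r] open_ball]]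
  show ?thesis
  proof (rule has_field_derivative_transform_within_open)
    show "open ?U" "w0 $ k \<in> ?U" using r by auto
    show "1 / (2 * of_real pi * \<i>) * integral (cbox 0 1) (ckernel j (w0 $ j) r f (cupd w0 k s)) =
        pderivative j f (cupd w0 k s)" if "s \<in> ?U" for s
      by (rule pderivative_integral[OF f p U[OF that], symmetric])
  qed
qed

lemma holo_pderivative:
  assumes S: "open S" and f: "holo S f" shows "holo S (pderivative j f)"
  unfolding holo_def
proof (intro conjI ballI allI)
  show "continuous_on S (pderivative j f)" by (rule continuous_pderivative[OF S f])
  fix w k assume w: "w \<in> S"
  show "(\<lambda>t. pderivative j f (cupd w k t)) field_differentiable at (w $ k)"
  proof (cases "j = k")
    case True
    have "deriv (\<lambda>t. f (cupd w k t)) holomorphic_on {t. cupd w k t \<in> S}"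
      by (intro holomorphic_deriv holo_slice[OF f] holo_slice_open[OF S])
    then have "(\<lambda>t. pderivative k f (cupd w k t)) holomorphic_on {t. cupd w k t \<in> S}"
      by (simp add: pderivative_cupd)
    from holomorphic_on_imp_differentiable_at[OF this holo_slice_open[OF S]] w
    show ?thesis unfolding True by simp
  next
    case False
    obtain r where "poly_ball S w r" using poly_ball_exists[OF S w] by blast
    from pderivative_slice_other[OF S f this False] show ?thesis
      by (auto simp: field_differentiable_def)
  qed
qed

lemma pderivative_commute:
  assumes S: "open S" and f: "holo S f" and w: "w \<in> S"
  shows "pderivative j (pderivative k f) w = pderivative k (pderivative j f) w"
proof (cases "j = k")
  case False
  obtain r where p: "poly_ball S w r" using poly_ball_exists[OF S w] by blast
  then have "w \<in> ball w r" by (simp add: poly_ball_def)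
  from pderivative_integral[OF holo_pderivative[OF S f, of k] p this, of j]
    DERIV_imp_deriv[OF pderivative_slice_other[OF S f p False]]
  show ?thesis unfolding pderivative_def[of k "pderivative j f"] by (rule trans[OF _ sym])
qed auto

lemma pderivative_eqI:
  "((\<lambda>t. f (cupd w j t)) has_field_derivative D) (at (w $ j)) \<Longrightarrow> pderivative j f w = D"
  unfolding pderivative_def by (rule DERIV_imp_deriv)

lemma pderivative_cong_open:
  assumes S: "open S" and w: "w \<in> S" and g: "holo S g" and eq: "\<And>v. v \<in> S \<Longrightarrow> f v = g v"
  shows "pderivative j f w = pderivative j g w"
proof (rule pderivative_eqI)
  show "((\<lambda>t. f (cupd w j t)) has_field_derivative pderivative j g w) (at (w $ j))"
    by (rule has_field_derivative_transform_within_open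
        [OF pderivative_slice[OF g w] holo_slice_open[OF S, of w j]]) (use w eq in auto)
qed

lemma holoI:
  assumes "continuous_on S f"
    and "\<And>w j. w \<in> S \<Longrightarrow> ((\<lambda>t. f (cupd w j t)) has_field_derivative D w j) (at (w $ j))"
  shows "holo S f"
  using assms unfolding holo_def field_differentiable_def by blast

lemma holo_const: "holo S (\<lambda>w. c)"
  by (rule holoI[where D = "\<lambda>w j. 0"]) auto

lemma holo_coord: "holo S (\<lambda>w. w $ i)"
  by (rule holoI[where D = "\<lambda>w j. if i = j then 1 else 0"]) (auto intro!: continuous_intros)

lemma holo_add:
  assumes "holo S f" "holo S g"
  shows "holo S (\<lambda>w. f w + g w)"
    and "w \<in> S \<Longrightarrow> pderivative j (\<lambda>w. f w + g w) w = pderivative j f w + pderivative j g w"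
proof -
  have d: "((\<lambda>t. f (cupd w j t) + g (cupd w j t)) has_field_derivative
      pderivative j f w + pderivative j g w) (at (w $ j))" if "w \<in> S" for w j
    by (intro DERIV_add pderivative_slice[OF assms(1) that] pderivative_slice[OF assms(2) that])
  show "holo S (\<lambda>w. f w + g w)"
    using assms by (intro holoI[OF _ d] continuous_intros) (auto simp: holo_def)
  show "w \<in> S \<Longrightarrow> pderivative j (\<lambda>w. f w + g w) w = pderivative j f w + pderivative j g w"
    by (intro pderivative_eqI d)
qed

lemma holo_mult:
  assumes "holo S f" "holo S g"
  shows "holo S (\<lambda>w. f w * g w)"
    and "w \<in> S \<Longrightarrow> pderivative j (\<lambda>w. f w * g w) w =
           f w * pderivative j g w + pderivative j f w * g w"
proof -
  have d: "((\<lambda>t. f (cupd w j t) * g (cupd w j t)) has_field_derivative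
      f w * pderivative j g w + pderivative j f w * g w) (at (w $ j))" if "w \<in> S" for w j
    using DERIV_mult'[OF pderivative_slice[OF assms(1) that] pderivative_slice[OF assms(2) that]]
    by simp
  show "holo S (\<lambda>w. f w * g w)"
    using assms by (intro holoI[OF _ d] continuous_intros) (auto simp: holo_def)
  show "w \<in> S \<Longrightarrow> pderivative j (\<lambda>w. f w * g w) w =
      f w * pderivative j g w + pderivative j f w * g w"
    by (intro pderivative_eqI d)
qed

lemma pderivative_const: "pderivative j (\<lambda>w. c) w = 0"
  by (rule pderivative_eqI) auto

lemma pderivative_coord: "pderivative j (\<lambda>w. w $ i) w = (if i = j then 1 else 0)"
  by (rule pderivative_eqI) auto

lemma holo_sum:
  assumes "finite A" "\<And>i. i \<in> A \<Longrightarrow> holo S (h i)"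
  shows "holo S (\<lambda>w. \<Sum>i\<in>A. h i w) \<and>
    (\<forall>w\<in>S. pderivative j (\<lambda>w. \<Sum>i\<in>A. h i w) w = (\<Sum>i\<in>A. pderivative j (h i) w))"
  using assms
proof (induction A rule: finite_induct)
  case (insert x F)
  then have "holo S (h x)" "holo S (\<lambda>w. \<Sum>i\<in>F. h i w)" by auto
  from holo_add[OF this] insert show ?case by simp
qed (simp add: holo_const pderivative_const)

lemma holo_cmult: "holo S f \<Longrightarrow> holo S (\<lambda>w. c * f w)"
  by (rule holo_mult(1)[OF holo_const])

lemma holo_minus: "holo S f \<Longrightarrow> holo S (\<lambda>w. - f w)"
  using holo_cmult[of S f "-1"] by simp

lemma holo_diff: "holo S f \<Longrightarrow> holo S g \<Longrightarrow> holo S (\<lambda>w. f w - g w)"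
  using holo_add(1)[of S f "\<lambda>w. - g w"] holo_minus[of S g] by simp

lemma pderivative_cmult: "holo S f \<Longrightarrow> w \<in> S \<Longrightarrow> pderivative j (\<lambda>w. c * f w) w = c * pderivative j f w"
  using holo_mult(2)[OF holo_const, of S f w j c] by (simp add: pderivative_const)

lemma pderivative_diff:
  "holo S f \<Longrightarrow> holo S g \<Longrightarrow> w \<in> S \<Longrightarrow>
   pderivative j (\<lambda>w. f w - g w) w = pderivative j f w - pderivative j g w"
  using holo_add(2)[of S f "\<lambda>w. (-1) * g w" w j] holo_cmult[of S g "-1"] pderivative_cmult[of S g w j "-1"]
  by simp

subsection \<open>Hyperfunctions on $\mathbb{R}^4$\<close>

text \<open>
  The space of hyperfunctions is the relative cohomology $H^4_{\mathbb{R}^4}(\mathbb{C}^4, \mathcal{O})$.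
  By Leray's theorem, applied to the covering of $\mathbb{C}^4 - \mathbb{R}^4$ by the Stein open sets
  $\{\mathrm{Im}\, w_j \neq 0\}$, this is
  $\mathcal{O}(T) / \sum_j \mathcal{O}(T_j)$ with $T = \{w \mid \mathrm{Im}\, w_k \neq 0
  \mbox{ for all } k\}$ and $T_j = \{w \mid \mathrm{Im}\, w_k \neq 0 \mbox{ for all } k \neq j\}$.
  Representatives are total functions that are holomorphic on \<open>T\<close>; their values outside \<open>T\<close> are
  irrelevant.
\<close>

definition tube :: "4 set \<Rightarrow> (complex^4) set" where
  "tube J = {w. \<forall>j\<in>J. Im (w $ j) \<noteq> 0}"

lemma open_tube: "open (tube J)"
proof -
  have "tube J = (\<Inter>j\<in>J. {w. Im (w $ j) \<noteq> 0})" by (auto simp: tube_def)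
  moreover have "open {w::complex^4. Im (w $ j) \<noteq> 0}" for j
    by (rule open_Collect_neq) (auto intro!: continuous_intros)
  ultimately show ?thesis by auto
qed

lemma tube_antimono: "J \<subseteq> K \<Longrightarrow> tube K \<subseteq> tube J"
  by (auto simp: tube_def)

definition hyp_null :: "(complex^4 \<Rightarrow> complex) \<Rightarrow> bool" where
  "hyp_null f \<longleftrightarrow> (\<exists>h. (\<forall>j. holo (tube (UNIV - {j})) (h j)) \<and>
     (\<forall>w\<in>tube UNIV. f w = (\<Sum>j\<in>UNIV. h j w)))"

definition hyp_eq :: "(complex^4 \<Rightarrow> complex) \<Rightarrow> (complex^4 \<Rightarrow> complex) \<Rightarrow> bool" where
  "hyp_eq f g \<longleftrightarrow> holo (tube UNIV) f \<and> holo (tube UNIV) g \<and> hyp_null (\<lambda>w. f w - g w)"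

lemma hyp_null_zero: "(\<And>w. w \<in> tube UNIV \<Longrightarrow> f w = 0) \<Longrightarrow> hyp_null f"
  unfolding hyp_null_def by (rule exI[of _ "\<lambda>j w. 0"]) (auto simp: holo_const)

lemma hyp_null_add:
  assumes "hyp_null f" "hyp_null g" shows "hyp_null (\<lambda>w. f w + g w)"
proof -
  obtain h k where "\<forall>j. holo (tube (UNIV - {j})) (h j)" "\<forall>w\<in>tube UNIV. f w = (\<Sum>j\<in>UNIV. h j w)"
    "\<forall>j. holo (tube (UNIV - {j})) (k j)" "\<forall>w\<in>tube UNIV. g w = (\<Sum>j\<in>UNIV. k j w)"
    using assms unfolding hyp_null_def by metis
  then show ?thesis
    unfolding hyp_null_def
    by (intro exI[of _ "\<lambda>j w. h j w + k j w"]) (auto simp: holo_add sum.distrib)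
qed

lemma hyp_null_mult:
  assumes "hyp_null f" "\<And>J. holo (tube J) g" shows "hyp_null (\<lambda>w. g w * f w)"
proof -
  obtain h where "\<forall>j. holo (tube (UNIV - {j})) (h j)" "\<forall>w\<in>tube UNIV. f w = (\<Sum>j\<in>UNIV. h j w)"
    using assms unfolding hyp_null_def by metis
  then show ?thesis
    unfolding hyp_null_def
    by (intro exI[of _ "\<lambda>j w. g w * h j w"]) (auto simp: holo_mult assms sum_distrib_left)
qed

lemma hyp_null_pderivative:
  assumes "hyp_null f" shows "hyp_null (pderivative i f)"
proof -
  obtain h where h: "\<forall>j. holo (tube (UNIV - {j})) (h j)" "\<forall>w\<in>tube UNIV. f w = (\<Sum>j\<in>UNIV. h j w)"
    using assms unfolding hyp_null_def by metis
  have hU: "holo (tube UNIV) (h j)" for j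
    using h(1) holo_subset tube_antimono by (metis subset_UNIV)
  have s: "holo (tube UNIV) (\<lambda>w. \<Sum>j\<in>UNIV. h j w)"
    and d: "\<And>w. w \<in> tube UNIV \<Longrightarrow>
      pderivative i (\<lambda>w. \<Sum>j\<in>UNIV. h j w) w = (\<Sum>j\<in>UNIV. pderivative i (h j) w)"
    using holo_sum[of UNIV "tube UNIV" h i] hU by auto
  have "pderivative i f w = (\<Sum>j\<in>UNIV. pderivative i (h j) w)" if w: "w \<in> tube UNIV" for w
    using pderivative_cong_open[OF open_tube w s, of f i] h(2) d[OF w] by simp
  then show ?thesis
    unfolding hyp_null_def using h(1)
    by (intro exI[of _ "\<lambda>j. pderivative i (h j)"]) (auto intro: holo_pderivative open_tube)
qed

lemma hyp_null_minus: "hyp_null f \<Longrightarrow> hyp_null (\<lambda>w. - f w)"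
  using hyp_null_mult[OF _ holo_const, of f "-1"] by simp

lemma hyp_null_cong:
  "hyp_null f \<Longrightarrow> (\<And>w. w \<in> tube UNIV \<Longrightarrow> g w = f w) \<Longrightarrow> hyp_null g"
  unfolding hyp_null_def by metis

lemma hyp_eq_refl: "holo (tube UNIV) f \<Longrightarrow> hyp_eq f f"
  by (simp add: hyp_eq_def hyp_null_zero)

lemma hyp_eq_sym: "hyp_eq f g \<Longrightarrow> hyp_eq g f"
  unfolding hyp_eq_def using hyp_null_minus[of "\<lambda>w. f w - g w"] by auto

lemma hyp_eq_trans: "hyp_eq f g \<Longrightarrow> hyp_eq g h \<Longrightarrow> hyp_eq f h"
  unfolding hyp_eq_def using hyp_null_add[of "\<lambda>w. f w - g w" "\<lambda>w. g w - h w"] by auto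

lemma hyp_eqI:
  "holo (tube UNIV) f \<Longrightarrow> holo (tube UNIV) g \<Longrightarrow> (\<And>w. w \<in> tube UNIV \<Longrightarrow> f w = g w) \<Longrightarrow> hyp_eq f g"
  by (simp add: hyp_eq_def hyp_null_zero)

lemma hyp_eq_self: "hyp_eq f f \<longleftrightarrow> holo (tube UNIV) f"
  using hyp_eq_refl by (auto simp: hyp_eq_def)

quotient_type hyperfunction = "complex^4 \<Rightarrow> complex" / partial: hyp_eq
proof (rule part_equivpI)
  show "\<exists>f. hyp_eq f f" using hyp_eq_refl[OF holo_const] by blast
  show "symp hyp_eq" using hyp_eq_sym by (auto intro: sympI)
  show "transp hyp_eq" using hyp_eq_trans by (auto intro: transpI)
qed

instantiation hyperfunction :: ab_group_add
begin

lift_definition zero_hyperfunction :: hyperfunction is "\<lambda>w. 0"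
  by (rule hyp_eq_refl[OF holo_const])

lift_definition plus_hyperfunction :: "hyperfunction \<Rightarrow> hyperfunction \<Rightarrow> hyperfunction"
  is "\<lambda>f g w. f w + g w"
proof -
  fix f f' g g' assume "hyp_eq f f'" "hyp_eq g g'"
  then show "hyp_eq (\<lambda>w. f w + g w) (\<lambda>w. f' w + g' w)"
    using hyp_null_add[of "\<lambda>w. f w - f' w" "\<lambda>w. g w - g' w"]
    unfolding hyp_eq_def by (auto simp: holo_add algebra_simps)
qed

lift_definition uminus_hyperfunction :: "hyperfunction \<Rightarrow> hyperfunction" is "\<lambda>f w. - f w"
proof -
  fix f f' assume "hyp_eq f f'"
  then show "hyp_eq (\<lambda>w. - f w) (\<lambda>w. - f' w)"
    using hyp_null_minus[of "\<lambda>w. f w - f' w"]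
    unfolding hyp_eq_def by (auto simp: holo_minus)
qed

definition minus_hyperfunction :: "hyperfunction \<Rightarrow> hyperfunction \<Rightarrow> hyperfunction" where
  "minus_hyperfunction u v = u + (- v)"

instance
proof
  fix a b c :: hyperfunction
  show "a + b + c = a + (b + c)"
    by transfer (auto intro!: hyp_eqI holo_add simp: hyp_eq_def)
  show "a + b = b + a"
    by transfer (auto intro!: hyp_eqI holo_add simp: hyp_eq_def)
  show "0 + a = a"
    by transfer (auto intro!: hyp_eqI holo_add holo_const simp: hyp_eq_def)
  show "- a + a = 0"
    by transfer (auto intro!: hyp_eqI holo_add holo_minus holo_const simp: hyp_eq_def)
  show "a - b = a + - b" by (rule minus_hyperfunction_def)
qed

end

lift_definition hf_scale :: "complex \<Rightarrow> hyperfunction \<Rightarrow> hyperfunction" is "\<lambda>c f w. c * f w"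
proof -
  fix c f f' assume "hyp_eq f f'"
  then show "hyp_eq (\<lambda>w. c * f w) (\<lambda>w. c * f' w)"
    using hyp_null_mult[OF _ holo_const, of "\<lambda>w. f w - f' w" c]
    unfolding hyp_eq_def by (auto simp: holo_cmult algebra_simps)
qed

lift_definition hf_mult :: "4 \<Rightarrow> hyperfunction \<Rightarrow> hyperfunction" is "\<lambda>j f w. w $ j * f w"
proof -
  fix j f f' assume "hyp_eq f f'"
  then show "hyp_eq (\<lambda>w. w $ j * f w) (\<lambda>w. w $ j * f' w)"
    using hyp_null_mult[OF _ holo_coord, of "\<lambda>w. f w - f' w" j]
    unfolding hyp_eq_def by (auto simp: holo_mult holo_coord algebra_simps)
qed

lift_definition hf_diff :: "4 \<Rightarrow> hyperfunction \<Rightarrow> hyperfunction" is "pderivative"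
proof -
  fix j f f' assume "hyp_eq f f'"
  then have f: "holo (tube UNIV) f" "holo (tube UNIV) f'" "hyp_null (\<lambda>w. f w - f' w)"
    by (auto simp: hyp_eq_def)
  have "hyp_null (\<lambda>w. pderivative j f w - pderivative j f' w)"
    using hyp_null_pderivative[OF f(3), of j]
    by (rule hyp_null_cong) (simp add: pderivative_diff[OF f(1,2)])
  then show "hyp_eq (pderivative j f) (pderivative j f')"
    using f by (auto simp: hyp_eq_def intro: holo_pderivative open_tube)
qed

interpretation hf: vector_space hf_scale
  by standard (transfer, auto intro!: hyp_eqI holo_add holo_cmult holo_const simp: hyp_eq_def algebra_simps)+

lemma hf_mult_linear: "Vector_Spaces.linear hf_scale hf_scale (hf_mult j)"
  by (unfold_locales; transfer)
     (auto intro!: hyp_eqI holo_add holo_cmult holo_mult holo_coord simp: hyp_eq_def algebra_simps)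

lemma hf_diff_linear: "Vector_Spaces.linear hf_scale hf_scale (hf_diff j)"
proof (unfold_locales; transfer)
  fix j f g assume "hyp_eq f f" "hyp_eq g g"
  then have "holo (tube UNIV) f" "holo (tube UNIV) g" by (auto simp: hyp_eq_self)
  then show "hyp_eq (pderivative j (\<lambda>w. f w + g w)) (\<lambda>w. pderivative j f w + pderivative j g w)"
    by (intro hyp_eqI holo_add holo_pderivative open_tube)
next
  fix j c f assume "hyp_eq f f"
  then have "holo (tube UNIV) f" by (auto simp: hyp_eq_self)
  then show "hyp_eq (pderivative j (\<lambda>w. c * f w)) (\<lambda>w. c * pderivative j f w)"
    by (intro hyp_eqI holo_cmult holo_pderivative open_tube pderivative_cmult)
qed

lemma hf_mult_commute: "hf_mult i (hf_mult j u) = hf_mult j (hf_mult i u)"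
proof transfer
  fix i j f assume "hyp_eq f f"
  then have "holo (tube UNIV) f" by (auto simp: hyp_eq_self)
  then show "hyp_eq (\<lambda>w. w $ i * (w $ j * f w)) (\<lambda>w. w $ j * (w $ i * f w))"
    by (intro hyp_eqI holo_mult holo_coord mult.left_commute)
qed

lemma hf_diff_commute: "hf_diff i (hf_diff j u) = hf_diff j (hf_diff i u)"
proof transfer
  fix i j f assume "hyp_eq f f"
  then have "holo (tube UNIV) f" by (auto simp: hyp_eq_self)
  then show "hyp_eq (pderivative i (pderivative j f)) (pderivative j (pderivative i f))"
    by - (rule hyp_eqI, (blast intro: holo_pderivative open_tube pderivative_commute)+)
qed

lemma hf_diff_mult: "hf_diff i (hf_mult j u) = hf_mult j (hf_diff i u) + hf_scale (of_bool (i = j)) u"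
proof transfer
  fix i j f assume "hyp_eq f f"
  then have f: "holo (tube UNIV) f" by (auto simp: hyp_eq_self)
  show "hyp_eq (pderivative i (\<lambda>w. w $ j * f w)) (\<lambda>w. w $ j * pderivative i f w + of_bool (i = j) * f w)"
  proof (rule hyp_eqI)
    fix w :: "complex^4" assume "w \<in> tube UNIV"
    from holo_mult(2)[OF holo_coord f this]
    show "pderivative i (\<lambda>w. w $ j * f w) w = w $ j * pderivative i f w + of_bool (i = j) * f w"
      by (simp add: pderivative_coord)
  qed (intro holo_pderivative holo_add holo_mult holo_cmult holo_coord open_tube f)+
qed

lemma hf_mult_add: "hf_mult j (u + v) = hf_mult j u + hf_mult j v"
  and hf_mult_scale: "hf_mult j (hf_scale c u) = hf_scale c (hf_mult j u)"
  using hf_mult_linear[of j] by (auto simp: Vector_Spaces.linear_iff)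

lemma hf_diff_add: "hf_diff j (u + v) = hf_diff j u + hf_diff j v"
  and hf_diff_scale: "hf_diff j (hf_scale c u) = hf_scale c (hf_diff j u)"
  using hf_diff_linear[of j] by (auto simp: Vector_Spaces.linear_iff)

subsection \<open>Complex coordinates\<close>

text \<open>
  The coordinates of $\mathbb{R}^4$ are $(x_1, y_1, x_2, y_2)$ with $z_1 = x_1 + i y_1$,
  $z_2 = x_2 + i y_2$, $z_3 = \overline{z_1}$, $z_4 = \overline{z_2}$ on the real form; \<open>hf_mult j\<close>
  and \<open>hf_diff j\<close> act by the \<open>j\<close>-th real coordinate and its partial derivative. \<open>hf_z\<close> multiplies
  by $z_i$, \<open>hf_dz\<close> is the Wirtinger derivative with respect to $z_i$. In the index type \<open>4\<close>
  the last index \<open>4\<close> equals \<open>0\<close>.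
\<close>

definition hf_z :: "4 \<Rightarrow> hyperfunction \<Rightarrow> hyperfunction" where
  "hf_z i u =
    (if i = 1 then hf_mult 1 u + hf_scale \<i> (hf_mult 2 u)
     else if i = 2 then hf_mult 3 u + hf_scale \<i> (hf_mult 4 u)
     else if i = 3 then hf_mult 1 u - hf_scale \<i> (hf_mult 2 u)
     else hf_mult 3 u - hf_scale \<i> (hf_mult 4 u))"

definition hf_dz :: "4 \<Rightarrow> hyperfunction \<Rightarrow> hyperfunction" where
  "hf_dz i u =
    (if i = 1 then hf_scale (1/2) (hf_diff 1 u - hf_scale \<i> (hf_diff 2 u))
     else if i = 2 then hf_scale (1/2) (hf_diff 3 u - hf_scale \<i> (hf_diff 4 u))
     else if i = 3 then hf_scale (1/2) (hf_diff 1 u + hf_scale \<i> (hf_diff 2 u))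
     else hf_scale (1/2) (hf_diff 3 u + hf_scale \<i> (hf_diff 4 u)))"

lemma hf_mult_minus: "hf_mult j (u - v) = hf_mult j u - hf_mult j v"
  by (metis add_diff_cancel diff_add_cancel hf_mult_add)

lemma hf_diff_minus: "hf_diff j (u - v) = hf_diff j u - hf_diff j v"
  by (metis add_diff_cancel diff_add_cancel hf_diff_add)

lemmas hf_simps = hf_mult_add hf_mult_minus hf_mult_scale hf_diff_add hf_diff_minus hf_diff_scale
  hf.scale_right_distrib hf.scale_right_diff_distrib

lemma hf_z_add: "hf_z i (u + v) = hf_z i u + hf_z i v"
  and hf_z_scale: "hf_z i (hf_scale c u) = hf_scale c (hf_z i u)"
  and hf_dz_add: "hf_dz i (u + v) = hf_dz i u + hf_dz i v"
  and hf_dz_scale: "hf_dz i (hf_scale c u) = hf_scale c (hf_dz i u)"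
  by (simp_all add: hf_z_def hf_dz_def hf_simps algebra_simps)

lemma hf_z_commute: "hf_z i (hf_z j u) = hf_z j (hf_z i u)"
  by (simp add: hf_z_def hf_simps hf_mult_commute algebra_simps)

lemma hf_dz_commute: "hf_dz i (hf_dz j u) = hf_dz j (hf_dz i u)"
  by (simp add: hf_dz_def hf_simps hf_diff_commute algebra_simps)

lemma hf_dz_z: "hf_dz i (hf_z j u) = hf_z j (hf_dz i u) + hf_scale (of_bool (i = j)) u"
  using exhaust_4[of i] exhaust_4[of j]
  by (elim disjE) (simp_all add: hf_z_def hf_dz_def hf_simps hf_diff_mult algebra_simps
      flip: hf.scale_left_distrib)

subsection \<open>The ring of differential operators with polynomial coefficients\<close>

text \<open>
  The ring is presented by the generators $z_i$, $\partial_i$ over $\mathbb{C}$ and the relations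
  $[z_i, z_j] = [\partial_i, \partial_j] = 0$, $[\partial_i, z_j] = \delta_{ij}$. That it is the ring of
  operators on $\mathbb{C}[z_1, \dots, z_4]$ generated by multiplications and partial derivatives is
  \<open>weyl_faithful\<close> below, where a polynomial is given by its coefficients, indexed by multi-indices.
\<close>

datatype weyl_expr =
    WConst complex
  | WZ 4
  | WD 4
  | WAdd weyl_expr weyl_expr
  | WMul weyl_expr weyl_expr

inductive weyl_eq :: "weyl_expr \<Rightarrow> weyl_expr \<Rightarrow> bool" where
  weq_refl: "weyl_eq a a"
| weq_sym: "weyl_eq a b \<Longrightarrow> weyl_eq b a"
| weq_trans: "weyl_eq a b \<Longrightarrow> weyl_eq b c \<Longrightarrow> weyl_eq a c"
| weq_add_cong: "weyl_eq a a' \<Longrightarrow> weyl_eq b b' \<Longrightarrow> weyl_eq (WAdd a b) (WAdd a' b')"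
| weq_mul_cong: "weyl_eq a a' \<Longrightarrow> weyl_eq b b' \<Longrightarrow> weyl_eq (WMul a b) (WMul a' b')"
| weq_add_assoc: "weyl_eq (WAdd (WAdd a b) c) (WAdd a (WAdd b c))"
| weq_add_commute: "weyl_eq (WAdd a b) (WAdd b a)"
| weq_add_zero: "weyl_eq (WAdd (WConst 0) a) a"
| weq_mul_assoc: "weyl_eq (WMul (WMul a b) c) (WMul a (WMul b c))"
| weq_mul_one: "weyl_eq (WMul (WConst 1) a) a"
| weq_distrib_right: "weyl_eq (WMul (WAdd a b) c) (WAdd (WMul a c) (WMul b c))"
| weq_distrib_left: "weyl_eq (WMul a (WAdd b c)) (WAdd (WMul a b) (WMul a c))"
| weq_mul_zero: "weyl_eq (WMul (WConst 0) a) (WConst 0)"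
| weq_const_add: "weyl_eq (WAdd (WConst x) (WConst y)) (WConst (x + y))"
| weq_const_mul: "weyl_eq (WMul (WConst x) (WConst y)) (WConst (x * y))"
| weq_const_central: "weyl_eq (WMul (WConst x) a) (WMul a (WConst x))"
| weq_z_commute: "weyl_eq (WMul (WZ i) (WZ j)) (WMul (WZ j) (WZ i))"
| weq_d_commute: "weyl_eq (WMul (WD i) (WD j)) (WMul (WD j) (WD i))"
| weq_d_z: "weyl_eq (WMul (WD i) (WZ j)) (WAdd (WMul (WZ j) (WD i)) (WConst (of_bool (i = j))))"

quotient_type weyl = weyl_expr / weyl_eq
  by (auto intro!: equivpI reflpI sympI transpI intro: weq_refl weq_sym weq_trans)

lift_definition weyl_const :: "complex \<Rightarrow> weyl" is WConst .
lift_definition weyl_z :: "4 \<Rightarrow> weyl" is WZ .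
lift_definition weyl_d :: "4 \<Rightarrow> weyl" is WD .

primrec ps_eval :: "weyl_expr \<Rightarrow> ((4 \<Rightarrow> nat) \<Rightarrow> complex) \<Rightarrow> (4 \<Rightarrow> nat) \<Rightarrow> complex" where
  "ps_eval (WConst c) p = (\<lambda>\<alpha>. c * p \<alpha>)"
| "ps_eval (WZ i) p = (\<lambda>\<alpha>. if \<alpha> i = 0 then 0 else p (\<alpha>(i := \<alpha> i - 1)))"
| "ps_eval (WD i) p = (\<lambda>\<alpha>. of_nat (\<alpha> i + 1) * p (\<alpha>(i := \<alpha> i + 1)))"
| "ps_eval (WAdd a b) p = (\<lambda>\<alpha>. ps_eval a p \<alpha> + ps_eval b p \<alpha>)"
| "ps_eval (WMul a b) p = ps_eval a (ps_eval b p)"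

lemma ps_eval_add: "ps_eval e (\<lambda>\<alpha>. p \<alpha> + q \<alpha>) = (\<lambda>\<alpha>. ps_eval e p \<alpha> + ps_eval e q \<alpha>)"
proof (induction e arbitrary: p q)
  case (WMul a b)
  then show ?case by simp
qed (auto simp: algebra_simps fun_eq_iff)

lemma ps_eval_scale: "ps_eval e (\<lambda>\<alpha>. c * p \<alpha>) = (\<lambda>\<alpha>. c * ps_eval e p \<alpha>)"
proof (induction e arbitrary: p)
  case (WMul a b)
  then show ?case by simp
qed (auto simp: algebra_simps fun_eq_iff)

lemma ps_eval_weyl_eq: "weyl_eq a b \<Longrightarrow> ps_eval a p = ps_eval b p"
proof (induction arbitrary: p rule: weyl_eq.induct)
  case (weq_z_commute i j)
  show ?case by (cases "i = j") (auto simp: fun_eq_iff fun_upd_twist)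
next
  case (weq_d_commute i j)
  show ?case by (cases "i = j") (auto simp: fun_eq_iff fun_upd_twist)
next
  case (weq_d_z i j)
  show ?case by (cases "i = j") (auto simp: fun_eq_iff fun_upd_twist algebra_simps of_nat_diff)
qed (simp_all add: ps_eval_add ps_eval_scale algebra_simps)

instantiation weyl :: ring_1
begin

lift_definition zero_weyl :: weyl is "WConst 0" .
lift_definition one_weyl :: weyl is "WConst 1" .
lift_definition plus_weyl :: "weyl \<Rightarrow> weyl \<Rightarrow> weyl" is WAdd by (rule weq_add_cong)
lift_definition times_weyl :: "weyl \<Rightarrow> weyl \<Rightarrow> weyl" is WMul by (rule weq_mul_cong)
lift_definition uminus_weyl :: "weyl \<Rightarrow> weyl" is "WMul (WConst (-1))"
  by (intro weq_mul_cong weq_refl)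
definition minus_weyl :: "weyl \<Rightarrow> weyl \<Rightarrow> weyl" where "minus_weyl a b = a + (- b)"

instance
proof
  fix a b c :: weyl
  show "a + b + c = a + (b + c)" by transfer (rule weq_add_assoc)
  show "a + b = b + a" by transfer (rule weq_add_commute)
  show "0 + a = a" by transfer (rule weq_add_zero)
  show "a - b = a + - b" by (rule minus_weyl_def)
  show "a * b * c = a * (b * c)" by transfer (rule weq_mul_assoc)
  show "1 * a = a" by transfer (rule weq_mul_one)
  show "a * 1 = a" by transfer (rule weq_trans[OF weq_sym[OF weq_const_central] weq_mul_one])
  show "(a + b) * c = a * c + b * c" by transfer (rule weq_distrib_right)
  show "a * (b + c) = a * b + a * c" by transfer (rule weq_distrib_left)
  show "(0 :: weyl) \<noteq> 1"
  proof (transfer, rule notI)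
    assume "weyl_eq (WConst 0) (WConst 1)"
    from fun_cong[OF ps_eval_weyl_eq[OF this, of "\<lambda>_. 1"]] show False by simp
  qed
  show "- a + a = 0"
  proof transfer
    fix a
    have "weyl_eq (WAdd (WMul (WConst (-1)) a) a) (WAdd (WMul (WConst (-1)) a) (WMul (WConst 1) a))"
      by (intro weq_add_cong weq_refl weq_sym[OF weq_mul_one])
    moreover have "weyl_eq \<dots> (WMul (WAdd (WConst (-1)) (WConst 1)) a)"
      by (rule weq_sym[OF weq_distrib_right])
    moreover have "weyl_eq \<dots> (WMul (WConst 0) a)"
      using weq_mul_cong[OF weq_const_add[of "-1" 1] weq_refl] by simp
    ultimately show "weyl_eq (WAdd (WMul (WConst (-1)) a) a) (WConst 0)"
      by (meson weq_trans weq_mul_zero)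
  qed
qed

end

lift_definition ps_act :: "weyl \<Rightarrow> ((4 \<Rightarrow> nat) \<Rightarrow> complex) \<Rightarrow> (4 \<Rightarrow> nat) \<Rightarrow> complex" is ps_eval
  by (rule ext) (rule ps_eval_weyl_eq)

lemma ps_act_simps:
  "ps_act (weyl_const c) = (\<lambda>p \<alpha>. c * p \<alpha>)"
  "ps_act (weyl_z i) = (\<lambda>p \<alpha>. if \<alpha> i = 0 then 0 else p (\<alpha>(i := \<alpha> i - 1)))"
  "ps_act (weyl_d i) = (\<lambda>p \<alpha>. of_nat (\<alpha> i + 1) * p (\<alpha>(i := \<alpha> i + 1)))"
  by (transfer, simp add: fun_eq_iff)+

lemma ps_act_zero: "ps_act 0 p = (\<lambda>\<alpha>. 0)"
  by transfer simp
lemma ps_act_one: "ps_act 1 p = p"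
  by transfer simp
lemma ps_act_add: "ps_act (P + Q) p = (\<lambda>\<alpha>. ps_act P p \<alpha> + ps_act Q p \<alpha>)"
  by transfer simp
lemma ps_act_mult: "ps_act (P * Q) p = ps_act P (ps_act Q p)"
  by transfer simp

lemma weyl_const_zero [simp]: "weyl_const 0 = 0"
  by transfer (rule weq_refl)
lemma weyl_const_one [simp]: "weyl_const 1 = 1"
  by transfer (rule weq_refl)
lemma weyl_const_add: "weyl_const (x + y) = weyl_const x + weyl_const y"
  by transfer (rule weq_sym[OF weq_const_add])
lemma weyl_const_mult: "weyl_const (x * y) = weyl_const x * weyl_const y"
  by transfer (rule weq_sym[OF weq_const_mul])
lemma weyl_const_uminus: "weyl_const (- x) = - weyl_const x"
  using weyl_const_add[of x "- x"] by (simp add: eq_neg_iff_add_eq_0 add.commute)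
lemma weyl_const_central: "a * weyl_const x = weyl_const x * a"
  by transfer (rule weq_sym[OF weq_const_central])
lemma weyl_const_left: "a * (weyl_const x * b) = weyl_const x * (a * b)"
  by (metis weyl_const_central mult.assoc)
lemma weyl_z_commute: "weyl_z i * weyl_z j = weyl_z j * weyl_z i"
  by transfer (rule weq_z_commute)
lemma weyl_d_commute: "weyl_d i * weyl_d j = weyl_d j * weyl_d i"
  by transfer (rule weq_d_commute)
lemma weyl_d_z: "weyl_d i * weyl_z j = weyl_z j * weyl_d i + weyl_const (of_bool (i = j))"
  by transfer (rule weq_d_z)

definition weyl_mono :: "(4 \<Rightarrow> nat) \<Rightarrow> (4 \<Rightarrow> nat) \<Rightarrow> weyl" where
  "weyl_mono \<alpha> \<beta> =
     weyl_z 1 ^ \<alpha> 1 * (weyl_z 2 ^ \<alpha> 2 * (weyl_z 3 ^ \<alpha> 3 * (weyl_z 4 ^ \<alpha> 4 *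
    (weyl_d 1 ^ \<beta> 1 * (weyl_d 2 ^ \<beta> 2 * (weyl_d 3 ^ \<beta> 3 * weyl_d 4 ^ \<beta> 4))))))"

lemma weyl_z_power_commute: "weyl_z i * weyl_z j ^ n = weyl_z j ^ n * weyl_z i"
  by (metis power_commuting_commutes weyl_z_commute)

lemma weyl_d_power_commute: "weyl_d i * weyl_d j ^ n = weyl_d j ^ n * weyl_d i"
  by (metis power_commuting_commutes weyl_d_commute)

lemma weyl_d_z_power:
  "weyl_d i * weyl_z j ^ n =
   weyl_z j ^ n * weyl_d i + weyl_const (of_bool (i = j) * of_nat n) * weyl_z j ^ (n - 1)"
proof (induction n)
  case (Suc n)
  have "weyl_d i * weyl_z j ^ Suc n =
      weyl_z j * (weyl_d i * weyl_z j ^ n) + weyl_const (of_bool (i = j)) * weyl_z j ^ n"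
    by (simp add: weyl_d_z distrib_right flip: mult.assoc)
  also have "\<dots> = weyl_z j ^ Suc n * weyl_d i
      + weyl_const (of_bool (i = j) * of_nat n) * (weyl_z j * weyl_z j ^ (n - 1))
      + weyl_const (of_bool (i = j)) * weyl_z j ^ n"
    by (simp add: Suc.IH distrib_left weyl_const_left mult.assoc)
  also have "weyl_const (of_bool (i = j) * of_nat n) * (weyl_z j * weyl_z j ^ (n - 1)) =
      weyl_const (of_bool (i = j) * of_nat n) * weyl_z j ^ n"
    by (cases n) auto
  finally show ?case
    by (simp add: weyl_const_add distrib_left distrib_right algebra_simps)
qed simp

lemma weyl_z_mono: "weyl_z i * weyl_mono \<alpha> \<beta> = weyl_mono (\<alpha>(i := Suc (\<alpha> i))) \<beta>"
proof -
  have *: "weyl_z k * (weyl_z j ^ n * x) = weyl_z j ^ n * (weyl_z k * x)" for k j n x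
    by (metis mult.assoc weyl_z_power_commute)
  show ?thesis
    using exhaust_4[of i] by (elim disjE) (simp_all add: weyl_mono_def * mult.assoc)
qed

lemma weyl_d_mono:
  "weyl_d i * weyl_mono \<alpha> \<beta> = weyl_mono \<alpha> (\<beta>(i := Suc (\<beta> i)))
     + weyl_const (of_nat (\<alpha> i)) * weyl_mono (\<alpha>(i := \<alpha> i - 1)) \<beta>"
proof -
  have same: "weyl_d k * (weyl_z k ^ n * x) = weyl_z k ^ n * (weyl_d k * x)
     + weyl_const (of_nat n) * (weyl_z k ^ (n - 1) * x)" for k n x
    unfolding mult.assoc[symmetric] weyl_d_z_power by (simp add: distrib_right mult.assoc)
  have other: "weyl_d k * (weyl_z j ^ n * x) = weyl_z j ^ n * (weyl_d k * x)" if "k \<noteq> j" for k j n x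
    unfolding mult.assoc[symmetric] weyl_d_z_power using that by (simp add: distrib_right mult.assoc)
  have d_d: "weyl_d k * (weyl_d j ^ n * x) = weyl_d j ^ n * (weyl_d k * x)" for k j n x
    by (metis mult.assoc weyl_d_power_commute)
  have left: "weyl_z j ^ n * (weyl_const c * x) = weyl_const c * (weyl_z j ^ n * x)" for j n c x
    by (rule weyl_const_left)
  have d: "(1::4) \<noteq> 2" "(1::4) \<noteq> 3" "(1::4) \<noteq> 4" "(2::4) \<noteq> 3" "(2::4) \<noteq> 4" "(3::4) \<noteq> 4"
    "(2::4) \<noteq> 1" "(3::4) \<noteq> 1" "(4::4) \<noteq> 1" "(3::4) \<noteq> 2" "(4::4) \<noteq> 2" "(4::4) \<noteq> 3"
    by simp_all
  show ?thesis
    using exhaust_4[of i]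
    by (elim disjE; hypsubst)
       (simp_all only: weyl_mono_def same other[OF d(1)] other[OF d(2)] other[OF d(3)] other[OF d(4)]
          other[OF d(5)] other[OF d(6)] other[OF d(7)] other[OF d(8)] other[OF d(9)] other[OF d(10)]
          other[OF d(11)] other[OF d(12)] d_d weyl_d_power_commute distrib_left left
          fun_upd_apply d if_True if_False simp_thms power_Suc mult.assoc)
qed

definition weyl_nf :: "weyl \<Rightarrow> bool" where
  "weyl_nf P \<longleftrightarrow> (\<exists>F c. finite F \<and> P = (\<Sum>(\<alpha>, \<beta>)\<in>F. weyl_const (c \<alpha> \<beta>) * weyl_mono \<alpha> \<beta>))"

lemma weyl_nf_term: "weyl_nf (weyl_const x * weyl_mono \<alpha> \<beta>)"
  unfolding weyl_nf_def
  by (rule exI[of _ "{(\<alpha>, \<beta>)}"], rule exI[of _ "\<lambda>_ _. x"]) simp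

lemma weyl_nf_mono: "weyl_nf (weyl_mono \<alpha> \<beta>)"
  using weyl_nf_term[of 1] by simp

lemma weyl_nf_zero: "weyl_nf 0"
  unfolding weyl_nf_def by (rule exI[of _ "{}"]) simp

lemma weyl_nf_add:
  assumes "weyl_nf P" "weyl_nf Q" shows "weyl_nf (P + Q)"
proof -
  obtain F c where P: "finite F" "P = (\<Sum>(\<alpha>, \<beta>)\<in>F. weyl_const (c \<alpha> \<beta>) * weyl_mono \<alpha> \<beta>)"
    using assms(1) unfolding weyl_nf_def by blast
  obtain G d where Q: "finite G" "Q = (\<Sum>(\<alpha>, \<beta>)\<in>G. weyl_const (d \<alpha> \<beta>) * weyl_mono \<alpha> \<beta>)"
    using assms(2) unfolding weyl_nf_def by blast
  have "P = (\<Sum>(\<alpha>, \<beta>)\<in>F \<union> G. weyl_const (if (\<alpha>, \<beta>) \<in> F then c \<alpha> \<beta> else 0) * weyl_mono \<alpha> \<beta>)"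
    unfolding P(2) by (rule sum.mono_neutral_cong_left) (use P Q in auto)
  moreover have "Q = (\<Sum>(\<alpha>, \<beta>)\<in>F \<union> G. weyl_const (if (\<alpha>, \<beta>) \<in> G then d \<alpha> \<beta> else 0) * weyl_mono \<alpha> \<beta>)"
    unfolding Q(2) by (rule sum.mono_neutral_cong_left) (use P Q in auto)
  ultimately have "P + Q = (\<Sum>(\<alpha>, \<beta>)\<in>F \<union> G. weyl_const
      ((if (\<alpha>, \<beta>) \<in> F then c \<alpha> \<beta> else 0) + (if (\<alpha>, \<beta>) \<in> G then d \<alpha> \<beta> else 0)) * weyl_mono \<alpha> \<beta>)"
    by (simp add: sum.distrib[symmetric] weyl_const_add distrib_right split_beta)
  then show ?thesis
    unfolding weyl_nf_def using P(1) Q(1)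
    by (intro exI[of _ "F \<union> G"]
          exI[of _ "\<lambda>\<alpha> \<beta>. (if (\<alpha>, \<beta>) \<in> F then c \<alpha> \<beta> else 0) + (if (\<alpha>, \<beta>) \<in> G then d \<alpha> \<beta> else 0)"]) auto
qed

lemma weyl_nf_sum: "(\<And>x. x \<in> F \<Longrightarrow> weyl_nf (f x)) \<Longrightarrow> weyl_nf (sum f F)"
  by (induction F rule: infinite_finite_induct) (auto intro: weyl_nf_zero weyl_nf_add)

lemma weyl_nf_const:
  assumes "weyl_nf P" shows "weyl_nf (weyl_const x * P)"
proof -
  obtain F c where P: "finite F" "P = (\<Sum>(\<alpha>, \<beta>)\<in>F. weyl_const (c \<alpha> \<beta>) * weyl_mono \<alpha> \<beta>)"
    using assms unfolding weyl_nf_def by blast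
  show ?thesis
    unfolding P(2) sum_distrib_left split_beta
    by (intro weyl_nf_sum) (auto simp: weyl_nf_term simp flip: mult.assoc weyl_const_mult)
qed

lemma weyl_nf_mult:
  assumes "\<And>\<alpha> \<beta>. weyl_nf (g * weyl_mono \<alpha> \<beta>)" "weyl_nf P" shows "weyl_nf (g * P)"
proof -
  obtain F c where P: "finite F" "P = (\<Sum>(\<alpha>, \<beta>)\<in>F. weyl_const (c \<alpha> \<beta>) * weyl_mono \<alpha> \<beta>)"
    using assms(2) unfolding weyl_nf_def by blast
  show ?thesis
    unfolding P(2) sum_distrib_left split_beta weyl_const_left
    by (intro weyl_nf_sum weyl_nf_const assms(1))
qed

lemma weyl_induct [case_names const z d add mult]:
  fixes P :: weyl
  assumes "\<And>c. Q (weyl_const c)" "\<And>i. Q (weyl_z i)" "\<And>i. Q (weyl_d i)"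
    and "\<And>a b. Q a \<Longrightarrow> Q b \<Longrightarrow> Q (a + b)" "\<And>a b. Q a \<Longrightarrow> Q b \<Longrightarrow> Q (a * b)"
  shows "Q P"
proof -
  have "Q (abs_weyl e)" for e
    by (induction e)
       (use assms in \<open>simp_all flip: weyl_const.abs_eq weyl_z.abs_eq weyl_d.abs_eq
          plus_weyl.abs_eq times_weyl.abs_eq\<close>)
  then show ?thesis by (metis Quotient_abs_rep Quotient_weyl)
qed

lemma weyl_normal_form: "weyl_nf P"
proof -
  have "\<forall>Q. weyl_nf Q \<longrightarrow> weyl_nf (P * Q)"
  proof (induction P rule: weyl_induct)
    case (const c)
    show ?case by (simp add: weyl_nf_const)
  next
    case (z i)
    show ?case using weyl_nf_mult[of "weyl_z i"] by (simp add: weyl_z_mono weyl_nf_mono)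
  next
    case (d i)
    show ?case using weyl_nf_mult[of "weyl_d i"]
      by (simp add: weyl_d_mono weyl_nf_add weyl_nf_mono weyl_nf_term)
  next
    case (add a b)
    then show ?case by (simp add: distrib_right weyl_nf_add)
  next
    case (mult a b)
    then show ?case by (simp add: mult.assoc)
  qed
  moreover have "weyl_nf 1"
    using weyl_nf_mono[of "\<lambda>_. 0" "\<lambda>_. 0"] by (simp add: weyl_mono_def)
  ultimately have "weyl_nf (P * 1)" by blast
  then show ?thesis by simp
qed

lemma ps_act_z_power:
  "ps_act (weyl_z i ^ n) p = (\<lambda>\<alpha>. if n \<le> \<alpha> i then p (\<alpha>(i := \<alpha> i - n)) else 0)"
  by (induction n) (auto simp: ps_act_one ps_act_mult ps_act_simps fun_eq_iff)

lemma ps_act_d_power: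
  "ps_act (weyl_d i ^ n) p = (\<lambda>\<alpha>. fact (\<alpha> i + n) / fact (\<alpha> i) * p (\<alpha>(i := \<alpha> i + n)))"
proof (induction n)
  case (Suc n)
  show ?case
  proof
    fix \<alpha>
    have e: "\<alpha>(i := \<alpha> i + 1, i := (\<alpha>(i := \<alpha> i + 1)) i + n) = \<alpha>(i := \<alpha> i + Suc n)"
      by simp
    have "(of_nat (\<alpha> i + 1) :: complex) * (fact ((\<alpha>(i := \<alpha> i + 1)) i + n) / fact ((\<alpha>(i := \<alpha> i + 1)) i)) =
        fact (\<alpha> i + Suc n) / fact (\<alpha> i)"
      by (simp add: divide_simps del: of_nat_add of_nat_Suc)
    then show "ps_act (weyl_d i ^ Suc n) p \<alpha> =
        fact (\<alpha> i + Suc n) / fact (\<alpha> i) * p (\<alpha>(i := \<alpha> i + Suc n))"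
      unfolding power_Suc ps_act_mult Suc.IH ps_act_simps e mult.assoc[symmetric] by (rule arg_cong)
  qed
qed (simp add: ps_act_one)

lemma ps_act_mono:
  "ps_act (weyl_mono \<alpha> \<beta>) p \<gamma> = (if \<alpha> \<le> \<gamma>
     then (\<Prod>i\<in>UNIV. fact (\<gamma> i - \<alpha> i + \<beta> i) / fact (\<gamma> i - \<alpha> i)) * p (\<lambda>i. \<gamma> i - \<alpha> i + \<beta> i)
     else 0)"
proof -
  have d: "(1::4) \<noteq> 2" "(1::4) \<noteq> 3" "(1::4) \<noteq> 4" "(2::4) \<noteq> 3" "(2::4) \<noteq> 4" "(3::4) \<noteq> 4"
    "(2::4) \<noteq> 1" "(3::4) \<noteq> 1" "(4::4) \<noteq> 1" "(3::4) \<noteq> 2" "(4::4) \<noteq> 2" "(4::4) \<noteq> 3"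
    by simp_all
  have *: "ps_act (weyl_mono \<alpha> \<beta>) p \<gamma> =
     (if \<alpha> 1 \<le> \<gamma> 1 \<and> \<alpha> 2 \<le> \<gamma> 2 \<and> \<alpha> 3 \<le> \<gamma> 3 \<and> \<alpha> 4 \<le> \<gamma> 4
      then fact (\<gamma> 1 - \<alpha> 1 + \<beta> 1) / fact (\<gamma> 1 - \<alpha> 1) *
       (fact (\<gamma> 2 - \<alpha> 2 + \<beta> 2) / fact (\<gamma> 2 - \<alpha> 2) *
       (fact (\<gamma> 3 - \<alpha> 3 + \<beta> 3) / fact (\<gamma> 3 - \<alpha> 3) *
       (fact (\<gamma> 4 - \<alpha> 4 + \<beta> 4) / fact (\<gamma> 4 - \<alpha> 4) *
       p (\<gamma>(1 := \<gamma> 1 - \<alpha> 1, 2 := \<gamma> 2 - \<alpha> 2, 3 := \<gamma> 3 - \<alpha> 3, 4 := \<gamma> 4 - \<alpha> 4,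
           1 := \<gamma> 1 - \<alpha> 1 + \<beta> 1, 2 := \<gamma> 2 - \<alpha> 2 + \<beta> 2,
           3 := \<gamma> 3 - \<alpha> 3 + \<beta> 3, 4 := \<gamma> 4 - \<alpha> 4 + \<beta> 4)))))
      else 0)"
    unfolding weyl_mono_def ps_act_mult ps_act_z_power ps_act_d_power
    by (simp only: fun_upd_apply d if_True if_False simp_thms split: if_split) blast
  have u: "\<gamma>(1 := \<gamma> 1 - \<alpha> 1, 2 := \<gamma> 2 - \<alpha> 2, 3 := \<gamma> 3 - \<alpha> 3, 4 := \<gamma> 4 - \<alpha> 4,
           1 := \<gamma> 1 - \<alpha> 1 + \<beta> 1, 2 := \<gamma> 2 - \<alpha> 2 + \<beta> 2,
           3 := \<gamma> 3 - \<alpha> 3 + \<beta> 3, 4 := \<gamma> 4 - \<alpha> 4 + \<beta> 4) = (\<lambda>i. \<gamma> i - \<alpha> i + \<beta> i)"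
    (is "?l = ?r")
  proof
    fix i :: 4 show "?l i = ?r i"
      using exhaust_4[of i] by (elim disjE) simp_all
  qed
  have p: "prod f UNIV = f 1 * (f 2 * (f 3 * f 4))" for f :: "4 \<Rightarrow> complex"
    unfolding UNIV_4
    by (simp only: prod.insert finite.intros insert_iff empty_iff d simp_thms prod.empty mult_1_right)
  show ?thesis
    unfolding * u p le_fun_def forall_4 mult.assoc by (rule refl)
qed

lemma ps_act_sum: "ps_act (sum P F) p \<gamma> = (\<Sum>x\<in>F. ps_act (P x) p \<gamma>)"
  by (induction F rule: infinite_finite_induct) (auto simp: ps_act_zero ps_act_add)

lemma weyl_faithful:
  assumes "\<And>p. finite {\<alpha>. p \<alpha> \<noteq> 0} \<Longrightarrow> ps_act P p = ps_act Q p"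
  shows "P = Q"
proof -
  obtain F c where F: "finite F"
    and R: "P - Q = (\<Sum>(\<alpha>, \<beta>)\<in>F. weyl_const (c \<alpha> \<beta>) * weyl_mono \<alpha> \<beta>)"
    using weyl_normal_form[of "P - Q"] unfolding weyl_nf_def by blast
  have zero: "ps_act (P - Q) p \<gamma> = 0" if "finite {\<alpha>. p \<alpha> \<noteq> 0}" for p \<gamma>
    using fun_cong[OF ps_act_add[of "P - Q" Q p], of \<gamma>] assms[OF that] by simp
  define G where "G = {(\<alpha>, \<beta>) \<in> F. c \<alpha> \<beta> \<noteq> 0}"
  have "finite G" by (rule finite_subset[OF _ F]) (auto simp: G_def)
  have RG: "P - Q = (\<Sum>(\<alpha>, \<beta>)\<in>G. weyl_const (c \<alpha> \<beta>) * weyl_mono \<alpha> \<beta>)"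
    unfolding R G_def by (rule sum.mono_neutral_right) (use F in auto)
  have "G = {}"
  proof (rule ccontr)
    assume "G \<noteq> {}"
    then obtain x where x: "x \<in> G" and min: "\<And>y. y \<in> G \<Longrightarrow> sum (snd x) UNIV \<le> sum (snd y) UNIV"
      using arg_min_if_finite[OF \<open>finite G\<close>, of "\<lambda>y. sum (snd y) UNIV"]
      by (meson not_le)
    obtain a b where ab: "x = (a, b)" by fastforce
    define p :: "(4 \<Rightarrow> nat) \<Rightarrow> complex" where "p = (\<lambda>\<xi>. if \<xi> = b then 1 else 0)"
    have t: "ps_act (weyl_const (c \<alpha> \<beta>) * weyl_mono \<alpha> \<beta>) p a =
        (if (\<alpha>, \<beta>) = x then c a b * (\<Prod>i\<in>UNIV. fact (b i)) else 0)"
      if "(\<alpha>, \<beta>) \<in> G" for \<alpha> \<beta>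
    proof (cases "\<alpha> \<le> a \<and> (\<lambda>i. a i - \<alpha> i + \<beta> i) = b")
      case True
      then have le: "\<beta> i \<le> b i" and eq: "a i - \<alpha> i + \<beta> i = b i" for i by auto
      have "\<beta> = b"
      proof (rule ccontr)
        assume "\<beta> \<noteq> b"
        then obtain i where "\<beta> i \<noteq> b i" by (auto simp: fun_eq_iff)
        with le have "\<beta> i < b i" by (simp add: order.not_eq_order_implies_strict)
        with le have "sum \<beta> UNIV < sum b UNIV" by (intro sum_strict_mono_ex1) auto
        with min[OF that] ab show False by simp
      qed
      moreover have "\<alpha> = a"
      proof
        fix i from eq[of i] True \<open>\<beta> = b\<close> show "\<alpha> i = a i" by (simp add: le_fun_def order_antisym)
      qed
      ultimately show ?thesis
        by (simp add: ab ps_act_mult ps_act_simps ps_act_mono p_def)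
    next
      case False
      then show ?thesis
        by (auto simp: ab ps_act_mult ps_act_simps ps_act_mono p_def)
    qed
    have "ps_act (P - Q) p a = (\<Sum>y\<in>G. if y = x then c a b * (\<Prod>i\<in>UNIV. fact (b i)) else 0)"
      unfolding RG ps_act_sum by (rule sum.cong) (auto simp: t split: prod.split)
    also have "\<dots> = c a b * (\<Prod>i\<in>UNIV. fact (b i))"
      using x \<open>finite G\<close> by simp
    also have "\<dots> \<noteq> 0" using x ab by (simp add: G_def)
    finally have "ps_act (P - Q) p a \<noteq> 0" .
    moreover have "finite {\<alpha>. p \<alpha> \<noteq> 0}"
      by (rule finite_subset[of _ "{b}"]) (auto simp: p_def)
    ultimately show False using zero by blast
  qed
  with RG show ?thesis by simp
qed

subsection \<open>The action on hyperfunctions\<close>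

primrec hf_eval :: "weyl_expr \<Rightarrow> hyperfunction \<Rightarrow> hyperfunction" where
  "hf_eval (WConst c) u = hf_scale c u"
| "hf_eval (WZ i) u = hf_z i u"
| "hf_eval (WD i) u = hf_dz i u"
| "hf_eval (WAdd a b) u = hf_eval a u + hf_eval b u"
| "hf_eval (WMul a b) u = hf_eval a (hf_eval b u)"

lemma hf_eval_add: "hf_eval e (u + v) = hf_eval e u + hf_eval e v"
  by (induction e arbitrary: u v) (simp_all add: hf_z_add hf_dz_add hf.scale_right_distrib)

lemma hf_eval_scale: "hf_eval e (hf_scale c u) = hf_scale c (hf_eval e u)"
  by (induction e arbitrary: u)
     (simp_all add: hf_z_scale hf_dz_scale hf.scale_right_distrib mult.commute)

lemma hf_eval_weyl_eq: "weyl_eq a b \<Longrightarrow> hf_eval a u = hf_eval b u"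
proof (induction arbitrary: u rule: weyl_eq.induct)
  case (weq_z_commute i j)
  show ?case by (simp add: hf_z_commute[of i j])
next
  case (weq_d_commute i j)
  show ?case by (simp add: hf_dz_commute[of i j])
next
  case (weq_d_z i j)
  show ?case by (simp add: hf_dz_z)
qed (simp_all add: hf_eval_add hf_eval_scale hf.scale_left_distrib add.assoc add.commute)

lift_definition hf_act :: "weyl \<Rightarrow> hyperfunction \<Rightarrow> hyperfunction" is hf_eval
  by (simp add: fun_eq_iff hf_eval_weyl_eq)

lemma hf_act_const [simp]: "hf_act (weyl_const c) u = hf_scale c u"
  by transfer simp
lemma hf_act_z [simp]: "hf_act (weyl_z i) u = hf_z i u"
  by transfer simp
lemma hf_act_d [simp]: "hf_act (weyl_d i) u = hf_dz i u"
  by transfer simp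
lemma hf_act_zero_left [simp]: "hf_act 0 u = 0"
  by transfer simp
lemma hf_act_one [simp]: "hf_act 1 u = u"
  by transfer simp
lemma hf_act_add_left: "hf_act (P + Q) u = hf_act P u + hf_act Q u"
  by transfer simp
lemma hf_act_mult: "hf_act (P * Q) u = hf_act P (hf_act Q u)"
  by transfer simp
lemma hf_act_add: "hf_act P (u + v) = hf_act P u + hf_act P v"
  by transfer (rule hf_eval_add)
lemma hf_act_scale: "hf_act P (hf_scale c u) = hf_scale c (hf_act P u)"
  by transfer (rule hf_eval_scale)
lemma hf_act_zero [simp]: "hf_act P 0 = 0"
  using hf_act_scale[of P 0 0] by simp

definition Sol :: "weyl set \<Rightarrow> hyperfunction set" where
  "Sol S = {u. \<forall>P\<in>S. hf_act P u = 0}"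

lemma subspace_Sol: "hf.subspace (Sol S)"
  by (rule hf.subspaceI)
     (auto simp: Sol_def hf_act_add hf_act_scale)

definition hf_independent :: "(nat \<Rightarrow> hyperfunction set) \<Rightarrow> bool" where
  "hf_independent V \<longleftrightarrow>
     (\<forall>F v. finite F \<longrightarrow> (\<forall>l\<in>F. v l \<in> V l) \<longrightarrow> (\<Sum>l\<in>F. v l) = 0 \<longrightarrow> (\<forall>l\<in>F. v l = 0))"

definition hf_sum :: "(nat \<Rightarrow> hyperfunction set) \<Rightarrow> hyperfunction set" where
  "hf_sum V = {\<Sum>l\<in>F. v l | F v. finite F \<and> (\<forall>l\<in>F. v l \<in> V l)}"

subsection \<open>The left ideals\<close>

definition left_ideal :: "weyl set \<Rightarrow> bool" where
  "left_ideal I \<longleftrightarrow> 0 \<in> I \<and> (\<forall>a\<in>I. \<forall>b\<in>I. a + b \<in> I) \<and> (\<forall>r. \<forall>a\<in>I. r * a \<in> I)"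

lemma left_ideal_hull: "left_ideal (left_ideal hull S)"
  by (rule hull_in) (auto simp: left_ideal_def)

definition ideal_I1 :: "nat \<Rightarrow> weyl set" where
  "ideal_I1 l = left_ideal hull
     {weyl_z 1 * weyl_d 1 - of_nat l, weyl_d 1 ^ (l + 1),
      weyl_z 2 * weyl_d 2 + of_nat l + 1, weyl_z 2 ^ (l + 1),
      weyl_d 3, weyl_z 4}"

definition ideal_I3 :: "weyl set" where
  "ideal_I3 = left_ideal hull {weyl_z 1 * weyl_d 1 + weyl_z 2 * weyl_d 2 + 1, weyl_d 3, weyl_z 4}"

subsection \<open>The Lie algebras, the homomorphism and the characters\<close>

definition mat_scale :: "complex \<Rightarrow> complex^4^4 \<Rightarrow> complex^4^4" where
  "mat_scale c A = (\<chi> i j. c * A $ i $ j)"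

interpretation gl4: vector_space mat_scale
  by standard (simp_all add: mat_scale_def vec_eq_iff algebra_simps)

definition matrix_unit :: "4 \<Rightarrow> 4 \<Rightarrow> complex^4^4" where
  "matrix_unit i j = (\<chi> r c. if r = i \<and> c = j then 1 else 0)"

definition lie_h1 :: "(complex^4^4) set" where
  "lie_h1 = gl4.span
     {matrix_unit 1 1, matrix_unit 2 2, matrix_unit 3 3, matrix_unit 4 4,
      matrix_unit 1 4, matrix_unit 2 4, matrix_unit 3 1, matrix_unit 3 2, matrix_unit 3 4}"

definition lie_h3 :: "(complex^4^4) set" where
  "lie_h3 = gl4.span
     {matrix_unit 1 1 + matrix_unit 2 2, matrix_unit 3 3 + matrix_unit 4 4,
      matrix_unit 1 4, matrix_unit 3 2}"

lemma lie_h3_subset: "lie_h3 \<subseteq> lie_h1"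
  unfolding lie_h3_def lie_h1_def
  by (rule gl4.span_minimal) (auto intro: gl4.span_base gl4.span_add)

definition rho :: "complex^4^4 \<Rightarrow> weyl" where
  "rho A = (\<Sum>i\<in>UNIV. \<Sum>j\<in>UNIV. weyl_const (A $ i $ j) * - (weyl_z j * weyl_d i))"

lemma rho_matrix_unit: "rho (matrix_unit i j) = - (weyl_z j * weyl_d i)"
proof -
  have "rho (matrix_unit i j) =
      (\<Sum>r\<in>UNIV. \<Sum>c\<in>UNIV. if c = j then if r = i then - (weyl_z c * weyl_d r) else 0 else 0)"
    unfolding rho_def matrix_unit_def by (intro sum.cong) auto
  then show ?thesis by (simp add: sum.delta)
qed

text \<open>Only the restriction of \<open>chi1 l\<close> to \<open>lie_h1\<close> matters; it vanishes on the nilpotent part.\<close>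

definition chi1 :: "nat \<Rightarrow> complex^4^4 \<Rightarrow> complex" where
  "chi1 l A = - of_nat l * A $ 1 $ 1 + (of_nat l + 1) * A $ 2 $ 2 + A $ 4 $ 4"

text \<open>By \<open>chi1_lie_h3\<close> below, any other index would give the same function on \<open>lie_h3\<close>.\<close>

definition chi3 :: "complex^4^4 \<Rightarrow> complex" where
  "chi3 = chi1 0"

lemma chi1_values:
  "chi1 l (matrix_unit 1 1) = - of_nat l" "chi1 l (matrix_unit 2 2) = of_nat l + 1"
  "chi1 l (matrix_unit 3 3) = 0" "chi1 l (matrix_unit 4 4) = 1"
  "i \<noteq> j \<Longrightarrow> chi1 l (matrix_unit i j) = 0"
  by (auto simp: chi1_def matrix_unit_def)

lemma chi1_linear:
  "chi1 l (A + B) = chi1 l A + chi1 l B" "chi1 l (mat_scale c A) = c * chi1 l A" "chi1 l 0 = 0"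
  by (simp_all add: chi1_def mat_scale_def algebra_simps)

lemma chi3_values:
  "chi3 (matrix_unit 1 1 + matrix_unit 2 2) = 1" "chi3 (matrix_unit 3 3 + matrix_unit 4 4) = 1"
  "chi3 (matrix_unit 1 4) = 0" "chi3 (matrix_unit 3 2) = 0"
  by (simp_all add: chi3_def chi1_linear chi1_values)

lemma chi1_lie_h3: "A \<in> lie_h3 \<Longrightarrow> chi1 l A = chi3 A"
  unfolding lie_h3_def
  by (induction rule: gl4.span_induct_alt) (auto simp: chi3_def chi1_linear chi1_values)

definition rho_minus :: "(complex^4^4 \<Rightarrow> complex) \<Rightarrow> (complex^4^4) set \<Rightarrow> weyl set" where
  "rho_minus c h = (\<lambda>A. rho A - weyl_const (c A)) ` h"

end

theory Submission
  imports Defs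
begin

text \<open>
  Since \<^const>\<open>hf_act\<close> makes the hyperfunctions a left module over the Weyl algebra, the theorem is
  a statement about that module. The annihilator of a hyperfunction is a left ideal,
  so \<open>u\<close> solves a left ideal iff its generators kill \<open>u\<close>; and as \<^const>\<open>rho\<close> is linear, \<open>u\<close> solves
  \<open>(\<rho> - \<chi>)(\<hh>)\<close> iff \<open>\<rho>(A) u = \<chi>(A) u\<close> for \<open>A\<close> in a spanning set of \<open>\<hh>\<close>.

  \<^item> The horizontal inclusions hold because \<open>\<rho>(A) - \<chi>(A)\<close> lies in the corresponding left ideal for
    each spanning element \<open>A\<close>. The operator \<open>- z\<^sub>j \<partial>\<^sub>i\<close> with \<open>i \<noteq> j\<close> is a left multiple of
    \<open>\<partial>\<^sub>i\<close> and also of \<open>z\<^sub>j\<close>, and every off-diagonal unit involved has \<open>i = 3\<close> or \<open>j = 4\<close>. The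
    value \<open>\<chi>(E\<^sub>4\<^sub>4) = 1\<close> fits \<open>z\<^sub>4\<close> because \<open>- z\<^sub>4 \<partial>\<^sub>4 - 1 = - \<partial>\<^sub>4 z\<^sub>4\<close>, and \<open>\<chi>(E\<^sub>3\<^sub>3) = 0\<close> fits
    \<open>\<partial>\<^sub>3\<close>.

  \<^item> The left vertical inclusion holds because all \<open>\<chi>\<^sub>l\<close> agree on \<open>\<hh>\<^sub>3 \<subseteq> \<hh>\<^sub>1\<close>. The right one holds
    because \<open>z\<^sub>1 \<partial>\<^sub>1 + z\<^sub>2 \<partial>\<^sub>2 + 1\<close> is the sum of the generators \<open>z\<^sub>1 \<partial>\<^sub>1 - l\<close> and
    \<open>z\<^sub>2 \<partial>\<^sub>2 + l + 1\<close>, in which \<open>l\<close> cancels. A solution space is a subspace, so it contains the sum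
    over \<open>l\<close> as soon as it contains each term.

  \<^item> The sums are direct because the \<open>E\<^sub>1\<^sub>1\<close> equation makes the \<open>l\<close>-th summand consist of
    eigenvectors of the Euler operator \<open>z\<^sub>1 \<partial>\<^sub>1\<close> with eigenvalue \<open>l\<close>, and eigenspaces for distinct
    eigenvalues are independent.
\<close>

lemma hf_act_uminus_left: "hf_act (- P) u = - hf_act P u"
  using hf_act_add_left[of "- P" P u] by (simp add: eq_neg_iff_add_eq_0)

lemma hf_act_diff_left: "hf_act (P - Q) u = hf_act P u - hf_act Q u"
  using hf_act_add_left[of P "- Q" u] by (simp add: hf_act_uminus_left)

lemma hf_act_sum: "hf_act P (sum v F) = (\<Sum>l\<in>F. hf_act P (v l))"
  by (induction F rule: infinite_finite_induct) (auto simp: hf_act_add)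

lemma weyl_const_of_nat: "weyl_const (of_nat n) = of_nat n"
  by (induction n) (simp_all add: weyl_const_add)

lemma hf_act_of_nat: "hf_act (of_nat n) u = hf_scale (of_nat n) u"
  by (simp flip: weyl_const_of_nat)

lemma left_ideal_annihilator: "left_ideal {P. hf_act P u = 0}"
  by (simp add: left_ideal_def hf_act_add_left hf_act_mult)

lemma Sol_antimono: "S \<subseteq> T \<Longrightarrow> Sol T \<subseteq> Sol S"
  by (auto simp: Sol_def)

lemma Sol_left_ideal_hull: "Sol (left_ideal hull S) = Sol S"
proof
  show "Sol (left_ideal hull S) \<subseteq> Sol S"
    by (intro Sol_antimono hull_subset)
  show "Sol S \<subseteq> Sol (left_ideal hull S)"
  proof
    fix u assume "u \<in> Sol S"
    then have "S \<subseteq> {P. hf_act P u = 0}" by (auto simp: Sol_def)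
    then have "left_ideal hull S \<subseteq> {P. hf_act P u = 0}"
      by (rule hull_minimal) (rule left_ideal_annihilator)
    then show "u \<in> Sol (left_ideal hull S)" by (auto simp: Sol_def)
  qed
qed

lemma rho_add: "rho (A + B) = rho A + rho B"
  by (simp add: rho_def weyl_const_add distrib_right sum.distrib del: mult_minus_right)

lemma rho_mat_scale: "rho (mat_scale c A) = weyl_const c * rho A"
  by (simp add: rho_def mat_scale_def weyl_const_mult sum_distrib_left mult.assoc)

lemma rho_zero: "rho 0 = 0"
  by (simp add: rho_def)

text \<open>The matrices \<open>A\<close> with \<open>\<rho>(A) u = c(A) u\<close> form a subspace.\<close>

lemma Sol_rho_minus_span:
  assumes add: "\<And>A B. c (A + B) = c A + c B"
    and scale: "\<And>k A. c (mat_scale k A) = k * c A"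
  shows "u \<in> Sol (rho_minus c (gl4.span B)) \<longleftrightarrow> (\<forall>A\<in>B. hf_act (rho A) u = hf_scale (c A) u)"
proof -
  have zero: "c 0 = 0" using add[of 0 0] by simp
  have "hf_act (rho A) u = hf_scale (c A) u"
    if B: "\<forall>A\<in>B. hf_act (rho A) u = hf_scale (c A) u" and A: "A \<in> gl4.span B" for A
    using A
  proof (induction rule: gl4.span_induct_alt)
    case base
    show ?case by (simp add: rho_zero zero)
  next
    case (step k A A')
    then show ?case using B
      by (simp add: rho_add rho_mat_scale add scale hf_act_add_left hf_act_mult
          hf.scale_left_distrib)
  qed
  moreover have "u \<in> Sol (rho_minus c (gl4.span B)) \<longleftrightarrow>
      (\<forall>A\<in>gl4.span B. hf_act (rho A) u = hf_scale (c A) u)"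
    by (simp add: Sol_def rho_minus_def hf_act_diff_left)
  ultimately show ?thesis by (meson gl4.span_base)
qed

lemma hf_act_rho_matrix_unit: "hf_act (rho (matrix_unit i j)) u = - hf_z j (hf_dz i u)"
  by (simp add: rho_matrix_unit hf_act_uminus_left hf_act_mult)

lemma hf_z_zero: "hf_z i 0 = 0"
  using hf_act_zero[of "weyl_z i"] by (simp del: hf_act_zero)

lemma hf_dz_zero: "hf_dz i 0 = 0"
  using hf_act_zero[of "weyl_d i"] by (simp del: hf_act_zero)

text \<open>Moving \<open>z\<^sub>j\<close> past \<open>\<partial>\<^sub>i\<close> produces a commutator exactly on the diagonal: this is the source of
  the value \<open>1\<close> of the characters at \<open>E\<^sub>4\<^sub>4\<close>.\<close>

lemma hf_z_dz_of_hf_z_eq_0: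
  assumes "hf_z j u = 0"
  shows "hf_z j (hf_dz i u) = (if i = j then - u else 0)"
  using hf_dz_z[of i j u] assms
  by (auto simp: hf_dz_zero eq_neg_iff_add_eq_0 split: if_splits)

lemma Sol_ideal_I1_iff:
  "u \<in> Sol (ideal_I1 l) \<longleftrightarrow>
     hf_z 1 (hf_dz 1 u) = hf_scale (of_nat l) u \<and> hf_act (weyl_d 1 ^ (l + 1)) u = 0 \<and>
     hf_z 2 (hf_dz 2 u) = - hf_scale (of_nat l + 1) u \<and> hf_act (weyl_z 2 ^ (l + 1)) u = 0 \<and>
     hf_dz 3 u = 0 \<and> hf_z 4 u = 0"
  unfolding ideal_I1_def Sol_left_ideal_hull
  unfolding Sol_def
  by (simp add: hf_act_add_left hf_act_diff_left hf_act_mult hf_act_of_nat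
      hf.scale_left_distrib add_eq_0_iff2 add.assoc del: power_Suc)

lemma Sol_ideal_I3_iff:
  "u \<in> Sol ideal_I3 \<longleftrightarrow>
     hf_z 1 (hf_dz 1 u) + hf_z 2 (hf_dz 2 u) + u = 0 \<and> hf_dz 3 u = 0 \<and> hf_z 4 u = 0"
  unfolding ideal_I3_def Sol_left_ideal_hull
  unfolding Sol_def
  by (simp add: hf_act_add_left hf_act_mult)

lemma Sol_ideal_I3_subset: "Sol ideal_I3 \<subseteq> Sol (rho_minus chi3 lie_h3)"
proof
  fix u assume "u \<in> Sol ideal_I3"
  then have u: "hf_z 1 (hf_dz 1 u) + hf_z 2 (hf_dz 2 u) + u = 0" "hf_dz 3 u = 0" "hf_z 4 u = 0"
    by (auto simp: Sol_ideal_I3_iff)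
  from u(1) have e: "- hf_z 1 (hf_dz 1 u) - hf_z 2 (hf_dz 2 u) = u"
    by (metis add_eq_0_iff minus_add_distrib uminus_add_conv_diff add.commute)
  show "u \<in> Sol (rho_minus chi3 lie_h3)"
    unfolding lie_h3_def
    by (subst Sol_rho_minus_span)
      (use e u in \<open>auto simp: chi3_def chi1_linear chi1_values rho_add hf_act_add_left
        hf_act_rho_matrix_unit hf_z_dz_of_hf_z_eq_0 hf_z_zero\<close>)
qed

lemma Sol_ideal_I1_subset: "Sol (ideal_I1 l) \<subseteq> Sol (rho_minus (chi1 l) lie_h1)"
proof
  fix u assume "u \<in> Sol (ideal_I1 l)"
  then show "u \<in> Sol (rho_minus (chi1 l) lie_h1)"
    unfolding lie_h1_def
    by (subst Sol_rho_minus_span)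
      (auto simp: Sol_ideal_I1_iff chi1_linear chi1_values hf_act_rho_matrix_unit
        hf_z_dz_of_hf_z_eq_0 hf_z_zero)
qed

lemma Sol_lie_h1_subset_lie_h3:
  "Sol (rho_minus (chi1 l) lie_h1) \<subseteq> Sol (rho_minus chi3 lie_h3)"
proof (rule Sol_antimono)
  have "rho_minus chi3 lie_h3 = rho_minus (chi1 l) lie_h3"
    by (simp add: rho_minus_def chi1_lie_h3)
  then show "rho_minus chi3 lie_h3 \<subseteq> rho_minus (chi1 l) lie_h1"
    using lie_h3_subset by (auto simp: rho_minus_def)
qed

lemma Sol_ideal_I1_subset_ideal_I3: "Sol (ideal_I1 l) \<subseteq> Sol ideal_I3"
  by (auto simp: Sol_ideal_I1_iff Sol_ideal_I3_iff hf.scale_left_distrib)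

lemma hf_sum_mono: "(\<And>l. V l \<subseteq> W l) \<Longrightarrow> hf_sum V \<subseteq> hf_sum W"
  unfolding hf_sum_def by blast

lemma hf_sum_subset_subspace:
  assumes "hf.subspace W" "\<And>l. V l \<subseteq> W"
  shows "hf_sum V \<subseteq> W"
  using assms by (auto simp: hf_sum_def intro!: hf.subspace_sum)

lemma hf_independent_mono:
  assumes "hf_independent W" "\<And>l. V l \<subseteq> W l"
  shows "hf_independent V"
  using assms unfolding hf_independent_def by (meson subsetD)

text \<open>Applying \<open>P - c\<^sub>m\<close> to a vanishing sum of eigenvectors removes the \<open>m\<close>-th term and multiplies
  the others by the nonzero numbers \<open>c\<^sub>l - c\<^sub>m\<close>, so induction on the number of terms applies.\<close>

lemma hf_independent_eigenspaces:
  assumes "inj c"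
  shows "hf_independent (\<lambda>l. {u. hf_act P u = hf_scale (c l) u})"
  unfolding hf_independent_def
proof (intro allI impI)
  fix F :: "nat set" and v
  assume "finite F"
    and "\<forall>l\<in>F. v l \<in> {u. hf_act P u = hf_scale (c l) u}"
    and "(\<Sum>l\<in>F. v l) = 0"
  then show "\<forall>l\<in>F. v l = 0"
  proof (induction F arbitrary: v rule: finite_induct)
    case (insert m F)
    have eig: "hf_act P (v l) = hf_scale (c l) (v l)" if "l \<in> insert m F" for l
      using insert.prems(1) that by blast
    let ?w = "\<lambda>l. hf_scale (c l - c m) (v l)"
    have "(\<Sum>l\<in>F. ?w l) = (\<Sum>l\<in>insert m F. ?w l)"
      using insert.hyps by simp
    also have "\<dots> = hf_act P (\<Sum>l\<in>insert m F. v l) - hf_scale (c m) (\<Sum>l\<in>insert m F. v l)"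
      unfolding hf_act_sum hf.scale_sum_right sum_subtractf[symmetric]
      by (rule sum.cong) (simp_all add: eig hf.scale_left_diff_distrib)
    also have "\<dots> = 0" using insert.prems(2) by simp
    finally have "\<forall>l\<in>F. ?w l = 0"
      by (intro insert.IH) (simp_all add: hf_act_scale eig hf.scale_left_commute)
    moreover have "c l - c m \<noteq> 0" if "l \<in> F" for l
      using insert.hyps(2) that assms by (auto dest: injD)
    ultimately have "\<forall>l\<in>F. v l = 0" by auto
    then show ?case using insert.prems(2) insert.hyps by simp
  qed simp
qed

lemma hf_independent_Sol_lie_h1: "hf_independent (\<lambda>l. Sol (rho_minus (chi1 l) lie_h1))"
proof (rule hf_independent_mono)
  show "hf_independent (\<lambda>l. {u. hf_act (rho (matrix_unit 1 1)) u = hf_scale (- of_nat l) u})"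
    by (rule hf_independent_eigenspaces) (simp add: inj_def)
  fix l
  show "Sol (rho_minus (chi1 l) lie_h1) \<subseteq>
      {u. hf_act (rho (matrix_unit 1 1)) u = hf_scale (- of_nat l) u}"
    unfolding lie_h1_def
    by (auto simp: Sol_rho_minus_span chi1_linear chi1_values simp del: hf.scale_minus_left)
qed

theorem theorem8:
  shows "hf_independent (\<lambda>l. Sol (rho_minus (chi1 l) lie_h1)) \<and>
    hf_independent (\<lambda>l. Sol (ideal_I1 l)) \<and>
    Sol (rho_minus chi3 lie_h3) \<supseteq> Sol ideal_I3 \<and>
    Sol (rho_minus chi3 lie_h3) \<supseteq> hf_sum (\<lambda>l. Sol (rho_minus (chi1 l) lie_h1)) \<and>
    Sol ideal_I3 \<supseteq> hf_sum (\<lambda>l. Sol (ideal_I1 l)) \<and>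
    hf_sum (\<lambda>l. Sol (rho_minus (chi1 l) lie_h1)) \<supseteq> hf_sum (\<lambda>l. Sol (ideal_I1 l))"
  by (intro conjI hf_independent_Sol_lie_h1 Sol_ideal_I3_subset hf_sum_mono Sol_ideal_I1_subset
      hf_independent_mono[OF hf_independent_Sol_lie_h1 Sol_ideal_I1_subset]
      hf_sum_subset_subspace subspace_Sol Sol_lie_h1_subset_lie_h3 Sol_ideal_I1_subset_ideal_I3)

end
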